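(* For generic $a\in\mathbb{C}^*$ (so that all terms are defined), $$\Big(1+\frac1a\Big)\sum_{n=0}^{\infty}q^{n+1}(-q/a;q)_n(-aq;q)_n=-1+a\,g(-a,q)+\frac{j(-a;q)}{J_1}\,m(a^2,q,-a^{-1})$$ $$=-1+a\,g(-a,q)+\frac{j(-a;q)}{J_1}\,m(a^2,q,-1)+\frac{1}{2}\frac{j(a;q)^3\,j(qa^2;q^2)}{J_2^2\,j(a^4;q^2)}.$$
   Context: $q$ is a complex number with $0<|q|<1$. $(x;q)_n=\prod_{i=0}^{n-1}(1-xq^i)$, $(x;q)_\infty=\prod_{i\ge0}(1-xq^i)$, $j(x;q)=(x;q)_\infty(q/x;q)_\infty(q;q)_\infty$, and $J_m=(q^m;q^m)_\infty$. The Appell--Lerch sum is $m(x,q,z)=\frac{1}{j(z;q)}\sum_{r\in\mathbb{Z}}\frac{(-1)^rq^{\binom r2}z^r}{1-q^{r-1}xz}$, and the universal mock theta function is $g(x,q)=x^{-1}\big(-1+\sum_{n=0}^{\infty}\frac{q^{n^2}}{(x;q)_{n+1}(q/x;q)_n}\big)$. *)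

theory Defs
  imports "HOL-Analysis.Analysis"
begin

definition qpoch :: "complex \<Rightarrow> complex \<Rightarrow> nat \<Rightarrow> complex" where
  "qpoch x q n = (\<Prod>i<n. 1 - x * q ^ i)"

definition qpoch_inf :: "complex \<Rightarrow> complex \<Rightarrow> complex" where
  "qpoch_inf x q = (\<Prod>i. 1 - x * q ^ i)"

definition theta_j :: "complex \<Rightarrow> complex \<Rightarrow> complex" where
  "theta_j x q = qpoch_inf x q * qpoch_inf (q / x) q * qpoch_inf q q"

definition J :: "complex \<Rightarrow> nat \<Rightarrow> complex" where
  "J q m = qpoch_inf (q ^ m) (q ^ m)"

(* The product r * (r - 1) is even and nonnegative for every integer r, so the integer
   division is exact and the exponent is binomial(r, 2). *)
definition appell_m :: "complex \<Rightarrow> complex \<Rightarrow> complex \<Rightarrow> complex" where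
  "appell_m x q z = 1 / theta_j z q *
     (\<Sum>\<^sub>\<infinity>r\<in>(UNIV :: int set).
        (-1) powi r * q powi (r * (r - 1) div 2) * z powi r / (1 - q powi (r - 1) * x * z))"

definition mock_g :: "complex \<Rightarrow> complex \<Rightarrow> complex" where
  "mock_g x q = inverse x *
     (-1 + (\<Sum>n. q ^ (n\<^sup>2) / (qpoch x q (n + 1) * qpoch (q / x) q n)))"

(* Division by zero is total in HOL, so the requirement that a term is defined is spelled
   out as the nonvanishing of every denominator occurring in it. *)

definition appell_m_defined :: "complex \<Rightarrow> complex \<Rightarrow> complex \<Rightarrow> bool" where
  "appell_m_defined x q z \<longleftrightarrow>
     z \<noteq> 0 \<and> theta_j z q \<noteq> 0 \<and> (\<forall>r::int. 1 - q powi (r - 1) * x * z \<noteq> 0)"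

definition mock_g_defined :: "complex \<Rightarrow> complex \<Rightarrow> bool" where
  "mock_g_defined x q \<longleftrightarrow>
     x \<noteq> 0 \<and> (\<forall>n. qpoch x q (n + 1) \<noteq> 0 \<and> qpoch (q / x) q n \<noteq> 0)"

end

(*
  Put x = - a. The series on the left and the one in g(x, q) are the two halves of a single
  bilateral series F(x): the substitution n -> - n - 1 exchanges them. Termwise telescoping gives
  F(q x) = - q x^3 F(x) + (1 - q x^2) (1/x; q)_inf (q x; q)_inf, and the Appell-Lerch series, divided
  by (q; q)_inf, satisfies the same equation. The difference, multiplied by j(x; q), extends to a
  holomorphic function d on the punctured plane with d(q x) = q x^2 d(x). Such a function is
  bounded, hence constant by Liouville's theorem (composed with exp), hence zero; no residue has
  to be computed.

  For the second equality, m(x, q, z1) - m(x, q, z0) is compared, as a function of x, with the theta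
  quotient of Hickerson and Mortenson. After clearing denominators the difference of the two sides
  vanishes on both zero orbits of j(x z0; q) j(x z1; q), and the quotient d satisfies
  d(q x) = - q x d(x), so the same argument applies. Product identities for theta functions of
  nomes q and q^2 then turn the quotient into the stated one.
*)
theory Submission
  imports Defs "HOL-Complex_Analysis.Complex_Analysis"
begin

subsection \<open>Holomorphic functions on the punctured plane\<close>

text \<open>The obstacle is the poles: the bilateral series and the Appell-Lerch series have them at
  powers of q, while Liouville's theorem needs functions on the whole punctured plane. They are
  removed term by term: quasi-periodicity moves j(y;q) to the argument q^r y, where the factor 1 -
  q^r y splits off and cancels the r-th denominator. The remaining quotients are bounded uniformly
  in r, so the regularised series is holomorphic for all nonzero y, and its value at y = 1 is
  explicit. The exponents in the functional equations of d matter: for |s| = 1 and k > 0 the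
  multiplier s q x^k has modulus at most 1 when |x| \<le> 1, and its value at x/q has modulus at
  least 1 when |x| \<ge> 1. So |d| grows neither towards 0 nor towards infinity. The Jacobi triple
  product enters because shifting an argument of the Appell-Lerch series by q leaves a plain theta
  series to be summed.\<close>

definition annulus :: "real \<Rightarrow> complex set" where
  "annulus R = {x. 1 / R \<le> norm x \<and> norm x \<le> R}"

lemma annulus_subset: "R > 0 \<Longrightarrow> annulus R \<subseteq> - {0}"
  by (force simp: annulus_def)

lemma compact_annulus: "compact (annulus R)"
proof -
  have eq: "annulus R = cball 0 R - ball 0 (1 / R)"
    by (auto simp: annulus_def not_less)
  show ?thesis unfolding eq by (intro compact_diff) auto
qed

lemma bounded_on_annulus:
  assumes "f holomorphic_on - {0}" "R > 0"
  obtains K :: real where "K > 0" "\<And>x. x \<in> annulus R \<Longrightarrow> norm (f x) \<le> K"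
proof -
  have "continuous_on (annulus R) f"
    using assms annulus_subset holomorphic_on_imp_continuous_on holomorphic_on_subset by metis
  then have "bounded (f ` annulus R)"
    using compact_annulus compact_continuous_image compact_imp_bounded by blast
  then show ?thesis using that unfolding bounded_pos by auto
qed

lemma cball_subset_annulus:
  assumes "x \<noteq> 0"
  obtains R e where "R > 1" "e > 0" "cball x e \<subseteq> annulus R"
proof -
  define R where "R = 2 + 2 * norm x + 2 / norm x"
  have "2 / norm x \<le> R" using assms by (simp add: R_def)
  then have *: "1 / R \<le> norm x / 2" "3 / 2 * norm x \<le> R"
    using assms by (auto simp: R_def field_simps add_pos_nonneg add_pos_pos)
  have "cball x (norm x / 2) \<subseteq> annulus R"
  proof
    fix y assume "y \<in> cball x (norm x / 2)"
    then have d: "norm (x - y) \<le> norm x / 2" by (simp add: dist_norm)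
    have "norm x \<le> norm (x - y) + norm y" "norm y \<le> norm x + norm (x - y)"
      using norm_triangle_ineq[of "x - y" y] norm_triangle_ineq4[of x "x - y"] by auto
    with d * show "y \<in> annulus R" unfolding annulus_def by auto
  qed
  moreover have "R > 1" using assms by (auto simp: R_def intro!: add_pos_nonneg)
  ultimately show ?thesis using assms by (intro that[of R "norm x / 2"]) auto
qed

text \<open>The Weierstrass M-test on a closed ball inside some annulus makes the net of finite
  partial sums converge uniformly there, and uniform limits of holomorphic functions are
  holomorphic.\<close>

lemma holomorphic_infsum:
  fixes f :: "'i \<Rightarrow> complex \<Rightarrow> complex"
  assumes hol: "\<And>i. f i holomorphic_on - {0}"
    and bd: "\<And>R. R > 1 \<Longrightarrow> \<exists>M. M summable_on I \<and> (\<forall>i\<in>I. \<forall>x\<in>annulus R. norm (f i x) \<le> M i)"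
  shows "(\<lambda>x. \<Sum>\<^sub>\<infinity>i\<in>I. f i x) holomorphic_on - {0}"
proof -
  have "open (- {0 :: complex})" by (simp add: open_Compl)
  moreover have "\<forall>x\<in>- {0}. \<exists>f'. ((\<lambda>x. \<Sum>\<^sub>\<infinity>i\<in>I. f i x) has_field_derivative f') (at x)"
  proof
    fix x :: complex assume "x \<in> - {0}"
    then obtain R e where R: "R > 1" "e > 0" "cball x e \<subseteq> annulus R"
      using cball_subset_annulus[of x] by auto
    have sub: "cball x e \<subseteq> - {0}" using R annulus_subset[of R] by (intro order_trans[OF R(3)]) auto
    obtain M where M: "M summable_on I" "\<And>i x. i \<in> I \<Longrightarrow> x \<in> annulus R \<Longrightarrow> norm (f i x) \<le> M i"
      using bd[OF R(1)] by blast
    have "uniform_limit (cball x e) (\<lambda>X y. \<Sum>i\<in>X. f i y) (\<lambda>y. \<Sum>\<^sub>\<infinity>i\<in>I. f i y) (finite_subsets_at_top I)"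
      using M R by (intro Weierstrass_m_test_general[where M=M]) auto
    moreover have "(\<lambda>y. \<Sum>i\<in>X. f i y) holomorphic_on cball x e" for X
      using sub hol by (intro holomorphic_on_sum) (meson holomorphic_on_subset)
    then have "\<forall>\<^sub>F X in finite_subsets_at_top I. continuous_on (cball x e) (\<lambda>y. \<Sum>i\<in>X. f i y)
                  \<and> (\<lambda>y. \<Sum>i\<in>X. f i y) holomorphic_on ball x e"
      using ball_subset_cball holomorphic_on_imp_continuous_on holomorphic_on_subset
      by (intro always_eventually) blast
    ultimately have "(\<lambda>y. \<Sum>\<^sub>\<infinity>i\<in>I. f i y) holomorphic_on ball x e"
      using holomorphic_uniform_limit[of x e "\<lambda>X y. \<Sum>i\<in>X. f i y" "finite_subsets_at_top I"]
        finite_subsets_at_top_neq_bot by blast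
    then show "\<exists>f'. ((\<lambda>x. \<Sum>\<^sub>\<infinity>i\<in>I. f i x) has_field_derivative f') (at x)"
      using \<open>e > 0\<close> by (simp add: holomorphic_on_open)
  qed
  ultimately show ?thesis by (simp only: holomorphic_on_open)
qed

lemma holomorphic_suminf:
  fixes f :: "nat \<Rightarrow> complex \<Rightarrow> complex"
  assumes hol: "\<And>i. f i holomorphic_on - {0}"
    and bd: "\<And>R. R > 1 \<Longrightarrow> \<exists>M. summable M \<and> (\<forall>i. \<forall>x\<in>annulus R. norm (f i x) \<le> M i)"
  shows "(\<lambda>x. \<Sum>i. f i x) holomorphic_on - {0}"
proof -
  \<comment> \<open>Nonnegativity of the majorant, read off at the point 1 of the annulus, turns its
    ordinary summability into unconditional summability.\<close>
  have pos: "norm (M i) = M i" if "\<forall>i. \<forall>x\<in>annulus R. norm (f i x) \<le> M i" "R > 1" for M R i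
  proof -
    have "1 \<in> annulus R" using that by (simp add: annulus_def)
    with that(1) have "norm (f i 1) \<le> M i" by blast
    with norm_ge_zero[of "f i 1"] have "0 \<le> M i" by linarith
    then show ?thesis by simp
  qed
  have "(\<lambda>x. \<Sum>\<^sub>\<infinity>i\<in>UNIV. f i x) holomorphic_on - {0}"
  proof (rule holomorphic_infsum[OF hol])
    fix R :: real assume R: "R > 1"
    then obtain M where M: "summable M" "\<forall>i. \<forall>x\<in>annulus R. norm (f i x) \<le> M i" using bd by blast
    then have "M summable_on UNIV"
      using pos[OF M(2) R] by (intro norm_summable_imp_summable_on) simp
    with M show "\<exists>M. M summable_on UNIV \<and> (\<forall>i\<in>UNIV. \<forall>x\<in>annulus R. norm (f i x) \<le> M i)" by blast
  qed
  moreover have "(\<Sum>\<^sub>\<infinity>i\<in>UNIV. f i x) = (\<Sum>i. f i x)" if x: "x \<in> - {0}" for x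
  proof -
    obtain R e where R: "R > 1" "e > 0" "cball x e \<subseteq> annulus R"
      using cball_subset_annulus[of x] x by auto
    then have "x \<in> annulus R" by auto
    moreover obtain M where M: "summable M" "\<forall>i. \<forall>x\<in>annulus R. norm (f i x) \<le> M i"
      using bd[OF R(1)] by blast
    ultimately have "norm (norm (f i x)) \<le> M i" for i by simp
    then have "summable (\<lambda>i. norm (f i x))"
      by (intro summable_comparison_test'[OF M(1), of 0])
    from norm_summable_imp_has_sum[OF this summable_sums[OF summable_norm_cancel[OF this]]]
    show ?thesis by (rule infsumI)
  qed
  ultimately show ?thesis by (rule holomorphic_transform[of "\<lambda>x. \<Sum>\<^sub>\<infinity>i. f i x"])
qed

text \<open>Tannery's theorem (dominated convergence for series): the majorant makes the partial
  sums uniform in \<open>n\<close>, so the two limits may be exchanged.\<close>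

lemma infsum_tendsto:
  fixes f :: "'i \<Rightarrow> nat \<Rightarrow> complex"
  assumes "\<And>i n. norm (f i n) \<le> M i" "M summable_on UNIV" "\<And>i. f i \<longlonglongrightarrow> g i"
  shows "(\<lambda>n. \<Sum>\<^sub>\<infinity>i. f i n) \<longlonglongrightarrow> (\<Sum>\<^sub>\<infinity>i. g i)"
proof -
  have gM: "norm (g i) \<le> M i" for i
    by (rule tendsto_upperbound[OF tendsto_norm[OF assms(3)]]) (auto simp: assms(1))
  have "(\<lambda>i. norm (g i)) summable_on UNIV"
    by (rule summable_on_comparison_test[OF assms(2)]) (auto simp: gM)
  then have "g summable_on UNIV" by (rule abs_summable_summable)
  then have *: "(sum g \<longlongrightarrow> (\<Sum>\<^sub>\<infinity>i. g i)) (finite_subsets_at_top UNIV)"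
    using has_sum_infsum has_sum_def by blast
  show ?thesis
  proof (rule swap_uniform_limit'[where S = UNIV])
    show "\<forall>\<^sub>F X in finite_subsets_at_top UNIV. ((\<lambda>n. \<Sum>i\<in>X. f i n) \<longlonglongrightarrow> sum g X)"
      by (intro always_eventually allI tendsto_sum assms)
    show "uniform_limit UNIV (\<lambda>X n. \<Sum>i\<in>X. f i n) (\<lambda>n. \<Sum>\<^sub>\<infinity>i. f i n) (finite_subsets_at_top UNIV)"
      using assms by (intro Weierstrass_m_test_general) auto
  qed (use * in auto)
qed

text \<open>Every nonzero x is reached from the annulus |q| \<le> |x| \<le> 1/|q| by repeated
  multiplication or division by q. Neither enlarges |f|, so the bound on this compact annulus is
  global.\<close>

lemma bounded_imp_constant_punctured:
  fixes f :: "complex \<Rightarrow> complex"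
  assumes hol: "f holomorphic_on - {0}" and q: "q \<noteq> 0" "norm q < 1"
    and in_le: "\<And>x. x \<noteq> 0 \<Longrightarrow> norm x \<le> 1 \<Longrightarrow> norm (f (q * x)) \<le> norm (f x)"
    and out_le: "\<And>x. norm x \<ge> 1 \<Longrightarrow> norm (f (x / q)) \<le> norm (f x)"
  shows "\<exists>c. \<forall>x. x \<noteq> 0 \<longrightarrow> f x = c"
proof -
  define R where "R = 1 / norm q"
  have R: "R > 1" using q by (simp add: R_def)
  obtain K where K: "\<And>x. x \<in> annulus R \<Longrightarrow> norm (f x) \<le> K"
    using bounded_on_annulus[OF hol, of R] R by auto
  have bd_in: "norm (f x) \<le> K" if "norm x \<le> 1" "norm x \<ge> norm q ^ n" "n > 0" for x n
    using that
  proof (induction n arbitrary: x)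
    case (Suc n)
    show ?case
    proof (cases "norm x \<ge> norm q")
      case True
      then show ?thesis using Suc q R
        by (intro K) (auto simp: annulus_def R_def intro: order_trans[of _ 1])
    next
      case False
      then have n: "n > 0" using Suc by (cases n) auto
      have "0 < norm q ^ Suc n" using q by simp
      with Suc.prems(2) have "0 < norm x" by linarith
      then have x0: "x \<noteq> 0" by simp
      have "norm (f (q * (x / q))) \<le> norm (f (x / q))"
        using x0 False q by (intro in_le) (auto simp: norm_divide)
      also have "\<dots> \<le> K" using False Suc q n by (intro Suc.IH) (auto simp: norm_divide field_simps)
      finally show ?thesis using q by simp
    qed
  qed auto
  have bd_out: "norm (f x) \<le> K" if "norm x \<ge> 1" "norm x * norm q ^ n \<le> 1" "n > 0" for x n
    using that
  proof (induction n arbitrary: x)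
    case (Suc n)
    show ?case
    proof (cases "norm x * norm q \<le> 1")
      case True
      then show ?thesis using Suc q R
        by (intro K) (auto simp: annulus_def R_def field_simps intro: order_trans[of _ 1])
    next
      case False
      then have n: "n > 0" using Suc by (cases n) auto
      have "norm (f (q * x / q)) \<le> norm (f (q * x))"
        using False q by (intro out_le) (auto simp: norm_mult mult.commute)
      also have "\<dots> \<le> K" using False Suc q n by (intro Suc.IH) (auto simp: norm_mult field_simps)
      finally show ?thesis using q by simp
    qed
  qed auto
  have bd: "norm (f x) \<le> K" if x: "x \<noteq> 0" for x
  proof (cases "norm x \<le> 1")
    case True
    obtain n where "norm q ^ n < norm x"
      using real_arch_pow_inv[of "norm x" "norm q"] q x by (metis zero_less_norm_iff)
    moreover have "norm q ^ Suc n \<le> norm q ^ n" using q by (intro power_decreasing) auto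
    ultimately show ?thesis using True by (intro bd_in[of _ "Suc n"]) auto
  next
    case False
    obtain n where n: "norm q ^ n < 1 / norm x"
      using real_arch_pow_inv[of "1 / norm x" "norm q"] q x by (metis zero_less_norm_iff zero_less_divide_1_iff)
    have "norm q ^ Suc n \<le> norm q ^ n" using q by (intro power_decreasing) auto
    with n have "norm q ^ Suc n < 1 / norm x" by linarith
    then have "norm x * norm q ^ Suc n \<le> 1" using x by (simp add: field_simps)
    then show ?thesis using False by (intro bd_out[of _ "Suc n"]) auto
  qed
  have "(f \<circ> exp) holomorphic_on UNIV"
    by (intro holomorphic_on_compose_gen[OF _ hol]) (auto intro: holomorphic_intros)
  moreover have "bounded (range (f \<circ> exp))"
    unfolding bounded_iff using bd by (intro exI[of _ K]) auto
  ultimately have "(f \<circ> exp) constant_on UNIV" by (rule Liouville_theorem)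
  then obtain c where "\<And>z. f (exp z) = c" by (auto simp: constant_on_def)
  then have "f x = c" if "x \<noteq> 0" for x using exp_Ln[OF that] by metis
  then show ?thesis by blast
qed

subsection \<open>Regularised theta functions and series over the integers\<close>

text \<open>The holomorphic continuation to \<open>w \<noteq> 0\<close> of \<open>theta_j w q / (1 - w)\<close>.\<close>
definition theta_reg :: "complex \<Rightarrow> complex \<Rightarrow> complex" where
  "theta_reg w q = qpoch_inf (q * w) q * qpoch_inf (q / w) q * qpoch_inf q q"

text \<open>It plays two roles: the r-th term of the Jacobi triple product series for
  \<open>theta_j z q\<close>, and the multiplier in the quasi-periodicity that relates
  \<open>theta_j z q\<close> to \<open>theta_j (q powi r * z) q\<close>.\<close>

definition theta_coeff :: "complex \<Rightarrow> int \<Rightarrow> complex \<Rightarrow> complex" where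
  "theta_coeff q r z = (-1) powi r * q powi (r * (r - 1) div 2) * z powi r"

text \<open>By quasi-periodicity this continues \<open>theta_j y q / (1 - q powi r * y)\<close> across its singularity.\<close>
definition theta_cut :: "complex \<Rightarrow> int \<Rightarrow> complex \<Rightarrow> complex" where
  "theta_cut q r y = theta_coeff q r y * theta_reg (q powi r * y) q"

lemma int_shift_induct:
  fixes P :: "int \<Rightarrow> bool"
  assumes "P 0" "\<And>r. P r \<longleftrightarrow> P (r + 1)"
  shows "P r"
proof (induction r rule: int_induct[where k = 0])
  case (step2 i)
  then show ?case using assms(2)[of "i - 1"] by simp
qed (use assms in auto)

lemma triangle_Suc: "(r + 1) * (r + 1 - 1) div 2 = r * (r - 1) div 2 + (r :: int)"
proof -
  have "(r + 1) * (r + 1 - 1) = r * (r - 1) + r * 2" by (simp add: algebra_simps)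
  then show ?thesis by (simp only: div_mult_self1 zero_neq_numeral not_False_eq_True)
qed

text \<open>The unnormalised Appell-Lerch series, with the pole variable \<open>y\<close>
  independent of the numerator variable \<open>z\<close> so that each can be shifted by q
  separately. In \<open>appell_m\<close> the two are tied by y = x z.\<close>

definition lerch :: "complex \<Rightarrow> complex \<Rightarrow> complex \<Rightarrow> complex" where
  "lerch q y z = (\<Sum>\<^sub>\<infinity>r. theta_coeff q r z / (1 - q powi r * y))"

text \<open>The continuation of \<open>theta_j y q * lerch q y z\<close> to all \<open>y \<noteq> 0\<close>.\<close>
definition lerch_reg :: "complex \<Rightarrow> complex \<Rightarrow> complex \<Rightarrow> complex" where
  "lerch_reg q y z = (\<Sum>\<^sub>\<infinity>r. theta_coeff q r z * theta_cut q r y)"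

text \<open>On the annulus, |z|^r is largest at the outer radius for r \<ge> 0 and at the inner
  radius for r < 0; adding both powers covers the two signs at once.\<close>

definition theta_majorant :: "complex \<Rightarrow> real \<Rightarrow> int \<Rightarrow> real" where
  "theta_majorant q R r = norm q powi (r * (r - 1) div 2) * (R powi r + inverse R powi r)"

text \<open>Ratio test: c p^n tends to 0, so the ratio is eventually below 1/2 whatever c
  is.\<close>

lemma summable_theta_half:
  fixes f :: "nat \<Rightarrow> real"
  assumes "0 < p" "p < 1" "\<And>n. f n \<ge> 0" "\<And>n. f (Suc n) \<le> c * p ^ n * f n"
  shows "summable f"
proof -
  have "(\<lambda>n. c * p ^ n) \<longlonglongrightarrow> c * 0"
    using assms by (intro tendsto_intros LIMSEQ_realpow_zero) auto
  then have "eventually (\<lambda>n. c * p ^ n < 1 / 2) sequentially"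
    by (rule order_tendstoD) auto
  then obtain N where N: "\<And>n. n \<ge> N \<Longrightarrow> c * p ^ n < 1 / 2"
    by (auto simp: eventually_sequentially)
  show ?thesis
  proof (rule summable_ratio_test[of "1 / 2" N])
    fix n assume "n \<ge> N"
    then have "c * p ^ n * f n \<le> 1 / 2 * f n"
      using N[of n] assms(3)[of n] by (intro mult_right_mono) auto
    with assms(4)[of n] show "norm (f (Suc n)) \<le> 1 / 2 * norm (f n)"
      using assms(3)[of n] assms(3)[of "Suc n"] by simp
  qed auto
qed

lemma summable_on_int:
  fixes f :: "int \<Rightarrow> real"
  assumes "\<And>r. f r \<ge> 0" "summable (\<lambda>n. f (int n))" "summable (\<lambda>n. f (- int n))"
  shows "f summable_on UNIV"
proof -
  have "f summable_on range int"
    using assms by (subst summable_on_reindex) (auto simp: o_def intro: summable_nonneg_imp_summable_on)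
  moreover have "f summable_on range (\<lambda>n. - int n)"
    using assms by (subst summable_on_reindex)
      (auto simp: o_def inj_on_def intro: summable_nonneg_imp_summable_on)
  moreover have "range int \<union> range (\<lambda>n. - int n) = UNIV"
    by (auto simp: image_def) (metis int_cases2)
  ultimately show ?thesis using summable_on_union by metis
qed

lemma summable_theta:
  fixes p t :: real
  assumes p: "0 < p" "p < 1" and t: "t > 0"
  shows "(\<lambda>r::int. p powi (r * (r - 1) div 2) * t powi r) summable_on UNIV"
proof -
  define f where "f = (\<lambda>r::int. p powi (r * (r - 1) div 2) * t powi r)"
  have rec: "f (r + 1) = t * p powi r * f r" for r
    unfolding f_def triangle_Suc using p t by (simp add: power_int_add)
  have nn: "f r \<ge> 0" for r using p t by (simp add: f_def)
  have "f summable_on UNIV"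
  proof (rule summable_on_int[OF nn])
    show "summable (\<lambda>n. f (int n))"
    proof (rule summable_theta_half[OF p nn])
      show "f (int (Suc n)) \<le> t * p ^ n * f (int n)" for n
        using rec[of "int n"] by (simp add: add.commute)
    qed
    show "summable (\<lambda>n. f (- int n))"
    proof (rule summable_theta_half[OF p nn])
      \<comment> \<open>The recursion \<open>rec\<close> read backwards; inverting t p^(-n-1) gives
        the constant p/t.\<close>
      show "f (- int (Suc n)) \<le> p / t * p ^ n * f (- int n)" for n
      proof -
        have "f (- int n) = t * p powi (- int (Suc n)) * f (- int (Suc n))"
          using rec[of "- int (Suc n)"] by simp
        also have "p powi (- int (Suc n)) = 1 / (p * p ^ n)"
          by (simp only: power_int_minus power_int_of_nat) (simp add: field_simps)
        finally show ?thesis using p t by simp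
      qed
    qed
  qed
  then show ?thesis by (simp add: f_def)
qed

lemma has_sum_int_shift:
  fixes f :: "int \<Rightarrow> 'a :: {comm_monoid_add, topological_space}"
  shows "((\<lambda>k. f (k + c)) has_sum s) UNIV \<longleftrightarrow> (f has_sum s) UNIV"
  by (rule has_sum_reindex_bij_betw) (rule bij_betw_byWitness[of _ "\<lambda>k. k - c"]; auto)

lemma infsum_int_shift:
  fixes f :: "int \<Rightarrow> 'a :: {comm_monoid_add, t2_space}"
  shows "(\<Sum>\<^sub>\<infinity>k. f (k + c)) = (\<Sum>\<^sub>\<infinity>k. f k)"
  by (rule infsum_reindex_bij_betw) (rule bij_betw_byWitness[of _ "\<lambda>k. k - c"]; auto)

section \<open>Nonvanishing of holomorphic functions\<close>

lemma nonzero_ball: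
  fixes h :: "complex \<Rightarrow> complex"
  assumes "open S" "h holomorphic_on S" "p \<in> S" "h p \<noteq> 0"
  obtains e where "e > 0" "ball p e \<subseteq> S" "\<And>w. w \<in> ball p e \<Longrightarrow> h w \<noteq> 0"
proof -
  have "open (S \<inter> h -` (- {0}))"
    using assms holomorphic_on_imp_continuous_on by (intro continuous_open_preimage) auto
  then obtain e where "e > 0" "ball p e \<subseteq> S \<inter> h -` (- {0})"
    using assms open_contains_ball_eq[of "S \<inter> h -` (- {0})" p] by auto
  then show ?thesis by (intro that[of e]) auto
qed

text \<open>A nonzero value would persist on a ball, which is uncountable. This extends functional
  equations across the zeros of theta functions, where their derivation divides by zero.\<close>

lemma vanish_off_countable:
  fixes f :: "complex \<Rightarrow> complex"
  assumes hol: "f holomorphic_on - {0}" and "countable Z"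
    and zero: "\<And>x. x \<noteq> 0 \<Longrightarrow> x \<notin> Z \<Longrightarrow> f x = 0" and x: "x \<noteq> 0"
  shows "f x = 0"
proof (rule ccontr)
  assume "f x \<noteq> 0"
  then obtain e where e: "e > 0" "ball x e \<subseteq> - {0}" "\<And>w. w \<in> ball x e \<Longrightarrow> f w \<noteq> 0"
    using nonzero_ball[OF _ hol, of x] x by (auto simp: open_Compl)
  then have "ball x e \<subseteq> Z" using zero by blast
  then show False
    using uncountable_ball[OF e(1)] \<open>countable Z\<close> countable_subset by blast
qed

text \<open>With x = -a the additional factor 1 - 1/x of (1/x;q)_(n+1) is the prefactor 1 + 1/a of
  the theorem, absorbed into the series.\<close>

definition upper_term :: "complex \<Rightarrow> complex \<Rightarrow> nat \<Rightarrow> complex" where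
  "upper_term q x n = qpoch (1 / x) q (n + 1) * qpoch (q * x) q n * q ^ (n + 1)"

text \<open>This is \<open>upper_term\<close> at the index \<open>- n - 1\<close>.\<close>
definition lower_term :: "complex \<Rightarrow> complex \<Rightarrow> nat \<Rightarrow> complex" where
  "lower_term q x n = q ^ (n\<^sup>2) / (qpoch x q (n + 1) * qpoch (q / x) q n)"

text \<open>The finite products in the denominator of \<open>lower_term\<close> are replaced by the
  complementary tails of the infinite products. This amounts to multiplying by j(x;q)/(q;q)_inf, and
  no pole is left.\<close>

definition lower_reg :: "complex \<Rightarrow> complex \<Rightarrow> nat \<Rightarrow> complex" where
  "lower_reg q x n = q ^ (n\<^sup>2) * (qpoch_inf (x * q ^ (n + 1)) q * qpoch_inf (q / x * q ^ n) q)"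

lemma inverse_in_annulus:
  assumes "R > 1" "x \<in> annulus R" shows "1 / x \<in> annulus R"
proof -
  have "norm x > 0" using assms by (auto simp: annulus_def intro: less_le_trans[of 0 "1 / R"])
  then show ?thesis using assms by (simp add: annulus_def norm_divide field_simps)
qed

text \<open>A locale, so that the same facts can be instantiated at the nome q^2 for the final
  product identities.\<close>

locale q_series =
  fixes q :: complex
  assumes q0: "q \<noteq> 0" and q1: "norm q < 1"
begin

subsection \<open>q-Pochhammer symbols and theta functions\<close>

lemma summable_q: "summable (\<lambda>i. c * norm q ^ i)"
  using q1 by (intro summable_mult summable_geometric) auto

lemma qpoch_Suc: "qpoch x q (Suc n) = qpoch x q n * (1 - x * q ^ n)"
  by (simp add: qpoch_def)

lemma qpoch_0 [simp]: "qpoch x q 0 = 1"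
  by (simp add: qpoch_def)

lemma qpoch_add: "qpoch x q (m + n) = qpoch x q m * qpoch (x * q ^ m) q n"
  by (induction n) (auto simp: qpoch_def power_add mult_ac)

lemma qpoch_Suc': "qpoch x q (Suc n) = (1 - x) * qpoch (x * q) q n"
  using qpoch_add[of x 1 n] by (simp add: qpoch_def)

text \<open>On a disc of radius R the sum of |x q^n| is dominated by a geometric series, which gives
  uniform convergence of the product. Absolute convergence identifies its limit with the infinite
  product.\<close>

lemma uniform_limit_qpoch:
  "uniform_limit (cball 0 R) (\<lambda>n x. qpoch x q n) (\<lambda>x. qpoch_inf x q) sequentially"
proof -
  have "uniformly_convergent_on (cball 0 R) (\<lambda>N x. \<Sum>n<N. norm (- x * q ^ n))"
  proof (rule Weierstrass_m_test'[OF _ summable_q[of R]])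
    show "norm (norm (- x * q ^ n)) \<le> R * norm q ^ n" if "x \<in> cball 0 R" for n x
      using that by (simp add: norm_mult norm_power mult_right_mono)
  qed
  then have "uniformly_convergent_on (cball 0 R) (\<lambda>N x. \<Prod>n<N. 1 + (- x * q ^ n))"
    by (intro uniformly_convergent_on_prod) (auto intro!: continuous_intros)
  then have ul: "uniform_limit (cball 0 R) (\<lambda>n x. qpoch x q n) (\<lambda>x. lim (\<lambda>n. qpoch x q n)) sequentially"
    by (simp add: qpoch_def uniformly_convergent_uniform_limit_iff)
  have "lim (\<lambda>n. qpoch x q n) = qpoch_inf x q" for x
  proof -
    have "abs_convergent_prod (\<lambda>i. 1 - x * q ^ i)"
      using summable_q[of "norm x"] by (simp add: abs_convergent_prod_conv_summable norm_mult norm_power)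
    then have "(\<lambda>i. 1 - x * q ^ i) has_prod qpoch_inf x q"
      unfolding qpoch_inf_def by (intro convergent_prod_has_prod abs_convergent_prod_imp_convergent_prod)
    then show ?thesis
      unfolding qpoch_def by (intro limI has_prod_imp_tendsto')
  qed
  with ul show ?thesis by simp
qed

lemma qpoch_tendsto: "(\<lambda>n. qpoch x q n) \<longlonglongrightarrow> qpoch_inf x q"
  by (rule tendsto_uniform_limitI[OF uniform_limit_qpoch[of "norm x"]]) auto

lemma qpoch_inf_split: "qpoch_inf x q = qpoch x q n * qpoch_inf (x * q ^ n) q"
proof (rule LIMSEQ_unique)
  show "(\<lambda>m. qpoch x q (m + n)) \<longlonglongrightarrow> qpoch_inf x q"
    using qpoch_tendsto by (rule LIMSEQ_ignore_initial_segment)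
  show "(\<lambda>m. qpoch x q (m + n)) \<longlonglongrightarrow> qpoch x q n * qpoch_inf (x * q ^ n) q"
    unfolding add.commute[of _ n] qpoch_add by (intro tendsto_intros qpoch_tendsto)
qed

lemma qpoch_inf_rec: "qpoch_inf x q = (1 - x) * qpoch_inf (q * x) q"
  using qpoch_inf_split[of x 1] by (simp add: qpoch_def mult.commute)

lemma qpoch_inf_eq_0_iff: "qpoch_inf x q = 0 \<longleftrightarrow> (\<exists>n. x * q ^ n = 1)"
proof -
  have "abs_convergent_prod (\<lambda>i. 1 - x * q ^ i)"
    using summable_q[of "norm x"] by (simp add: abs_convergent_prod_conv_summable norm_mult norm_power)
  then have "(\<lambda>i. 1 - x * q ^ i) has_prod qpoch_inf x q"
    unfolding qpoch_inf_def by (intro convergent_prod_has_prod abs_convergent_prod_imp_convergent_prod)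
  then have "qpoch_inf x q = 0 \<longleftrightarrow> (\<exists>i. 1 - x * q ^ i = 0)"
    using has_prod_eq_0_iff by fastforce
  then show ?thesis by (metis right_minus_eq)
qed

lemma qpoch_inf_q_nonzero: "qpoch_inf q q \<noteq> 0"
proof
  assume "qpoch_inf q q = 0"
  then obtain n where "q * q ^ n = 1" by (auto simp: qpoch_inf_eq_0_iff)
  then have "norm q ^ Suc n = 1" by (metis norm_one norm_power power_Suc)
  moreover have "norm q ^ Suc n < 1" using q0 q1 by (intro power_Suc_less_one) auto
  ultimately show False by simp
qed

lemma holomorphic_qpoch_inf_UNIV: "(\<lambda>x. qpoch_inf x q) holomorphic_on UNIV"
proof -
  have "(\<lambda>x. qpoch_inf x q) holomorphic_on ball 0 R" for R
  proof (rule holomorphic_uniform_limit[OF _ uniform_limit_qpoch])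
    show "\<forall>\<^sub>F n in sequentially. continuous_on (cball 0 R) (\<lambda>x. qpoch x q n) \<and>
            (\<lambda>x. qpoch x q n) holomorphic_on ball 0 R"
      unfolding qpoch_def by (intro always_eventually allI conjI continuous_intros holomorphic_intros)
  qed auto
  then have "(\<lambda>x. qpoch_inf x q) field_differentiable (at x)" for x
    using holomorphic_on_imp_differentiable_at[of _ "ball 0 (norm x + 1)" x] by auto
  then show ?thesis by (simp add: holomorphic_on_def)
qed

lemma holomorphic_qpoch_inf [holomorphic_intros]:
  assumes "f holomorphic_on A" shows "(\<lambda>x. qpoch_inf (f x) q) holomorphic_on A"
  using holomorphic_on_compose_gen[OF assms holomorphic_qpoch_inf_UNIV] by (simp add: o_def)

text \<open>From 1 + t \<le> exp t and the geometric series; the bound is independent of n.\<close>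

lemma norm_qpoch_le: "norm (qpoch x q n) \<le> exp (norm x / (1 - norm q))"
proof -
  have "norm (qpoch x q n) \<le> (\<Prod>i<n. 1 + norm x * norm q ^ i)"
    unfolding qpoch_def prod_norm[symmetric]
    by (intro prod_mono) (auto intro: order_trans[OF norm_triangle_ineq4] simp: norm_mult norm_power)
  also have "\<dots> \<le> exp (\<Sum>i<n. norm x * norm q ^ i)"
    by (intro prod_le_exp_sum) auto
  also have "(\<Sum>i<n. norm x * norm q ^ i) \<le> (\<Sum>i. norm x * norm q ^ i)"
    by (intro sum_le_suminf summable_q) auto
  also have "\<dots> = norm x / (1 - norm q)"
    using q1 by (simp add: suminf_mult suminf_geometric)
  finally show ?thesis by simp
qed

lemma holomorphic_theta_reg [holomorphic_intros]:
  assumes "f holomorphic_on A" "\<And>x. x \<in> A \<Longrightarrow> f x \<noteq> 0"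
  shows "(\<lambda>x. theta_reg (f x) q) holomorphic_on A"
  unfolding theta_reg_def by (intro holomorphic_intros assms)

lemma holomorphic_theta_j [holomorphic_intros]:
  assumes "f holomorphic_on A" "\<And>x. x \<in> A \<Longrightarrow> f x \<noteq> 0"
  shows "(\<lambda>x. theta_j (f x) q) holomorphic_on A"
  unfolding theta_j_def by (intro holomorphic_intros assms)

lemma theta_j_eq_theta_reg: "theta_j w q = (1 - w) * theta_reg w q"
  using qpoch_inf_rec[of w] by (simp add: theta_j_def theta_reg_def)

lemma theta_j_1 [simp]: "theta_j 1 q = 0"
  by (simp add: theta_j_eq_theta_reg)

lemma theta_j_shift: "w \<noteq> 0 \<Longrightarrow> theta_j (q * w) q = - theta_j w q / w"
  using q0 unfolding theta_j_def qpoch_inf_rec[of w]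
  by (simp add: qpoch_inf_rec[of "1 / w"] field_simps)

lemma theta_j_inverse: "w \<noteq> 0 \<Longrightarrow> theta_j (1 / w) q = - theta_j w q / w"
  using q0 unfolding theta_j_def qpoch_inf_rec[of w]
  by (simp add: qpoch_inf_rec[of "1 / w"] field_simps)

lemma theta_coeff_0 [simp]: "theta_coeff q 0 z = 1"
  by (simp add: theta_coeff_def)

lemma theta_coeff_Suc:
  "z \<noteq> 0 \<Longrightarrow> theta_coeff q (r + 1) z = - z * q powi r * theta_coeff q r z"
  unfolding theta_coeff_def triangle_Suc using q0 by (simp add: power_int_add)

lemma theta_coeff_mult: "theta_coeff q r (q * z) = q powi r * theta_coeff q r z"
  by (simp add: theta_coeff_def power_int_mult_distrib)

lemma theta_coeff_nonzero: "z \<noteq> 0 \<Longrightarrow> theta_coeff q r z \<noteq> 0"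
  using q0 by (simp add: theta_coeff_def power_int_not_zero)

lemma theta_j_shift_int:
  assumes w: "w \<noteq> 0" shows "theta_j w q = theta_coeff q r w * theta_j (q powi r * w) q"
proof (induction r rule: int_shift_induct)
  case (2 r)
  have "theta_j (q powi (r + 1) * w) q = theta_j (q * (q powi r * w)) q"
    using q0 by (simp add: power_int_add mult_ac)
  also have "\<dots> = - theta_j (q powi r * w) q / (q powi r * w)"
    using q0 w by (intro theta_j_shift) (simp add: power_int_not_zero)
  finally show ?case
    using q0 w by (simp add: theta_coeff_Suc power_int_not_zero)
qed simp

text \<open>The zero of \<open>theta_j y q\<close> at q^(-r) is moved to 1, where
  \<open>theta_j_eq_theta_reg\<close> exhibits it as a linear factor. This holds for every r with
  the same left-hand side, hence clears all denominators of \<open>lerch\<close> at once.\<close>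

lemma theta_j_eq_cut:
  assumes "y \<noteq> 0" shows "theta_j y q = (1 - q powi r * y) * theta_cut q r y"
  using theta_j_shift_int[OF assms, of r] by (simp add: theta_cut_def theta_j_eq_theta_reg)

lemma theta_j_eq_0_iff:
  assumes "w \<noteq> 0" shows "theta_j w q = 0 \<longleftrightarrow> (\<exists>r::int. q powi r * w = 1)"
proof
  assume "\<exists>r::int. q powi r * w = 1"
  then obtain r :: int where "q powi r * w = 1" ..
  then show "theta_j w q = 0" using theta_j_shift_int[OF assms, of r] by simp
next
  assume "theta_j w q = 0"
  then have "qpoch_inf w q = 0 \<or> qpoch_inf (q / w) q = 0 \<or> qpoch_inf q q = 0"
    by (simp add: theta_j_def)
  moreover note qpoch_inf_q_nonzero
  ultimately consider n where "w * q ^ n = 1" | n where "q / w * q ^ n = 1"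
    by (auto simp: qpoch_inf_eq_0_iff)
  then show "\<exists>r::int. q powi r * w = 1"
  proof cases
    case 1
    then show ?thesis by (intro exI[of _ "int n"]) (simp add: mult.commute)
  next
    case 2
    then have "w = q ^ Suc n" using assms by (simp add: field_simps)
    then have "q powi (- int (Suc n)) * w = 1" 
      using left_inverse[OF power_not_zero[OF q0, of "Suc n"]]
      by (simp only: power_int_minus power_int_of_nat)
    then show ?thesis by blast
  qed
qed

subsection \<open>Bounds for theta series\<close>

lemma summable_theta_majorant: "R > 1 \<Longrightarrow> theta_majorant q R summable_on UNIV"
  unfolding theta_majorant_def distrib_left
  using q0 q1 by (intro summable_on_add summable_theta) auto

lemma norm_theta_coeff_le:
  assumes R: "R > 1" and z: "z \<in> annulus R"
  shows "norm (theta_coeff q r z) \<le> theta_majorant q R r"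
proof -
  have z: "norm z \<le> R" "inverse R \<le> norm z" "norm z > 0"
    using z R by (auto simp: annulus_def field_simps intro: less_le_trans[of 0 "1/R"])
  have "norm z powi r \<le> R powi r + inverse R powi r"
  proof (cases "r \<ge> 0")
    case True
    then have "norm z powi r \<le> R powi r" using z by (intro power_int_mono) auto
    then show ?thesis using R by (simp add: add_increasing2)
  next
    case False
    then have "norm z powi r \<le> inverse R powi r"
      using z R by (intro power_int_antimono) auto
    then show ?thesis using R by (simp add: add_increasing)
  qed
  then show ?thesis
    by (auto simp: theta_coeff_def theta_majorant_def norm_mult norm_power_int intro!: mult_left_mono)
qed

lemma theta_majorant_nonneg: "R > 1 \<Longrightarrow> theta_majorant q R r \<ge> 0"
  by (simp add: theta_majorant_def)

lemma theta_majorant_bounded: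
  assumes "R > 1" obtains K where "\<And>r. theta_majorant q R r \<le> K"
proof -
  have "sum (theta_majorant q R) {r} \<le> infsum (theta_majorant q R) UNIV" for r
    using assms by (intro finite_sum_le_infsum summable_theta_majorant) (auto simp: theta_majorant_nonneg)
  then have "\<And>r. theta_majorant q R r \<le> infsum (theta_majorant q R) UNIV" by simp
  then show ?thesis by (rule that)
qed

text \<open>The bound must be uniform in r. If w = q^r y lies in \<open>annulus 2\<close>, both
  factors of \<open>theta_cut\<close> are bounded; otherwise |1 - w| \<ge> 1/2, and
  \<open>theta_cut\<close> is \<open>theta_j y q\<close> divided by 1 - w.\<close>

lemma theta_cut_bounded:
  assumes R: "R > 1"
  obtains K where "\<And>r y. y \<in> annulus R \<Longrightarrow> norm (theta_cut q r y) \<le> K"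
proof -
  have hol: "(\<lambda>y. theta_j y q) holomorphic_on - {0}" "(\<lambda>y. theta_reg y q) holomorphic_on - {0}"
    using q0 q1 by (auto intro!: holomorphic_theta_j holomorphic_theta_reg holomorphic_intros)
  have "R > 0" using R by simp
  from bounded_on_annulus[OF hol(1) this]
  obtain K1 where K1: "\<And>y. y \<in> annulus R \<Longrightarrow> norm (theta_j y q) \<le> K1" by blast
  from bounded_on_annulus[OF hol(2), of 2]
  obtain K2 where K2: "\<And>y. y \<in> annulus 2 \<Longrightarrow> norm (theta_reg y q) \<le> K2" "K2 > 0" by auto
  obtain K3 where K3: "\<And>r. theta_majorant q R r \<le> K3" using theta_majorant_bounded[OF R] by blast
  have "norm (theta_cut q r y) \<le> max (2 * K1) (K3 * K2)" if y: "y \<in> annulus R" for r y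
  proof (cases "q powi r * y \<in> annulus 2")
    case True
    have "norm (theta_coeff q r y) \<le> K3"
      using norm_theta_coeff_le[OF R y, of r] K3[of r] by linarith
    then have "norm (theta_cut q r y) \<le> K3 * K2"
      unfolding theta_cut_def norm_mult using K2(1)[OF True] K2(2)
      by (intro mult_mono) (auto intro: order_trans[OF norm_ge_zero])
    then show ?thesis by simp
  next
    case False
    define w where "w = q powi r * y"
    have "1 / 2 \<le> norm (1 - w)"
      using False norm_triangle_ineq2[of 1 w] norm_triangle_ineq3[of 1 w]
      unfolding w_def[symmetric] by (auto simp: annulus_def)
    then have le: "1 / 2 * norm (theta_cut q r y) \<le> norm (1 - w) * norm (theta_cut q r y)"
      by (intro mult_right_mono) auto
    have "y \<noteq> 0" using y R annulus_subset[of R] by auto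
    then have "norm (1 - w) * norm (theta_cut q r y) = norm (theta_j y q)"
      using theta_j_eq_cut[of y r] by (simp add: w_def norm_mult)
    with le show ?thesis using K1[OF y] by simp
  qed
  then show ?thesis using that by blast
qed

lemma nonzero_in_annulus:
  assumes "z \<noteq> 0" obtains R where "R > 1" "z \<in> annulus R"
  using cball_subset_annulus[OF assms] by (metis centre_in_cball less_imp_le subsetD)

lemma abs_summable_theta_coeff:
  assumes "z \<noteq> 0" shows "(\<lambda>r. norm (theta_coeff q r z)) summable_on UNIV"
proof -
  obtain R where R: "R > 1" "z \<in> annulus R" using nonzero_in_annulus[OF assms] .
  show ?thesis
    by (rule summable_on_comparison_test[OF summable_theta_majorant[OF R(1)]])
       (use R norm_theta_coeff_le in auto)
qed

lemma summable_theta_coeff: "z \<noteq> 0 \<Longrightarrow> (\<lambda>r. theta_coeff q r z) summable_on UNIV"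
  by (rule abs_summable_summable[OF abs_summable_theta_coeff])

lemma summable_lerch_reg:
  assumes "z \<noteq> 0" "y \<noteq> 0"
  shows "(\<lambda>r. theta_coeff q r z * theta_cut q r y) summable_on UNIV"
proof -
  obtain R where R: "R > 1" "y \<in> annulus R" using nonzero_in_annulus[OF assms(2)] .
  obtain K where K: "\<And>r. norm (theta_cut q r y) \<le> K" using theta_cut_bounded[OF R(1)] R(2) by metis
  have "(\<lambda>r. norm (theta_coeff q r z) * K) summable_on UNIV"
    by (intro summable_on_cmult_left abs_summable_theta_coeff assms)
  then have "(\<lambda>r. norm (theta_coeff q r z * theta_cut q r y)) summable_on UNIV"
    by (rule summable_on_comparison_test) (auto simp: norm_mult K intro: mult_left_mono)
  then show ?thesis by (rule abs_summable_summable)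
qed

text \<open>Both f and 1/f are bounded on the compact annulus. This lets the arguments of
  \<open>lerch_reg\<close> depend on x simultaneously.\<close>

lemma maps_annulus:
  assumes "f holomorphic_on - {0}" "\<And>x. x \<noteq> 0 \<Longrightarrow> f x \<noteq> 0" "R > 1"
  obtains R' where "R' > 1" "\<And>x. x \<in> annulus R \<Longrightarrow> f x \<in> annulus R'"
proof -
  have R: "R > 0" using assms by simp
  obtain K where K: "\<And>x. x \<in> annulus R \<Longrightarrow> norm (f x) \<le> K"
    using bounded_on_annulus[OF assms(1) R] by blast
  have "(\<lambda>x. 1 / f x) holomorphic_on - {0}"
    using assms by (intro holomorphic_intros) auto
  from bounded_on_annulus[OF this R]
  obtain L where L: "\<And>x. x \<in> annulus R \<Longrightarrow> norm (1 / f x) \<le> L" "L > 0" by blast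
  have "f x \<in> annulus (max 2 (max K L))" if x: "x \<in> annulus R" for x
  proof -
    have fx: "f x \<noteq> 0" using assms(2) x annulus_subset[OF R] by blast
    have "1 / max 2 (max K L) \<le> 1 / L" using L by (intro divide_left_mono) auto
    also have "1 / L \<le> norm (f x)" using L(1)[OF x] L(2) fx by (simp add: norm_divide field_simps)
    finally show ?thesis using K[OF x] by (simp add: annulus_def)
  qed
  then show ?thesis using that[of "max 2 (max K L)"] by simp
qed

lemma holomorphic_lerch_reg:
  assumes "f holomorphic_on - {0}" "\<And>x. x \<noteq> 0 \<Longrightarrow> f x \<noteq> 0"
    "g holomorphic_on - {0}" "\<And>x. x \<noteq> 0 \<Longrightarrow> g x \<noteq> 0"
  shows "(\<lambda>x. lerch_reg q (f x) (g x)) holomorphic_on - {0}"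
  unfolding lerch_reg_def
proof (rule holomorphic_infsum)
  show "(\<lambda>x. theta_coeff q r (g x) * theta_cut q r (f x)) holomorphic_on - {0}" for r
    unfolding theta_coeff_def theta_cut_def
    using assms q0 by (intro holomorphic_intros holomorphic_theta_reg) (auto simp: power_int_not_zero)
next
  fix R :: real assume R: "R > 1"
  obtain Rf where Rf: "Rf > 1" "\<And>x. x \<in> annulus R \<Longrightarrow> f x \<in> annulus Rf"
    using maps_annulus[OF assms(1,2) R] by blast
  obtain Rg where Rg: "Rg > 1" "\<And>x. x \<in> annulus R \<Longrightarrow> g x \<in> annulus Rg"
    using maps_annulus[OF assms(3,4) R] by blast
  obtain K where K: "\<And>r y. y \<in> annulus Rf \<Longrightarrow> norm (theta_cut q r y) \<le> K"
    using theta_cut_bounded[OF Rf(1)] by blast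
  show "\<exists>M. M summable_on UNIV \<and>
          (\<forall>r\<in>UNIV. \<forall>x\<in>annulus R. norm (theta_coeff q r (g x) * theta_cut q r (f x)) \<le> M r)"
  proof (intro exI conjI ballI)
    show "(\<lambda>r. theta_majorant q Rg r * K) summable_on UNIV"
      by (intro summable_on_cmult_left summable_theta_majorant Rg)
    show "norm (theta_coeff q r (g x) * theta_cut q r (f x)) \<le> theta_majorant q Rg r * K"
      if "x \<in> annulus R" for r x
      unfolding norm_mult using that K Rf Rg norm_theta_coeff_le[OF Rg(1)]
      by (intro mult_mono) (auto simp: theta_majorant_nonneg)
  qed
qed

subsection \<open>The Jacobi triple product\<close>

text \<open>The value \<open>0\<close> at negative arguments makes the recursion below hold for all integers.\<close>
definition inv_qfact :: "int \<Rightarrow> complex" where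
  "inv_qfact m = (if m < 0 then 0 else 1 / qpoch q q (nat m))"

lemma qpoch_q_nonzero: "qpoch q q n \<noteq> 0"
  using qpoch_inf_q_nonzero qpoch_inf_split[of q n] by auto

lemma inv_qfact_rec: "inv_qfact (m - 1) = (1 - q powi m) * inv_qfact m"
proof (cases "m \<le> 0")
  case True
  \<comment> \<open>At m = 0 the factor 1 - q^0 is 0, which matches the value 0 at -1.\<close>
  then show ?thesis by (cases "m = 0") (auto simp: inv_qfact_def)
next
  case False
  define n where "n = nat (m - 1)"
  have m: "m = int (Suc n)" using False by (simp add: n_def)
  have "qpoch q q (Suc n) = qpoch q q n * (1 - q ^ Suc n)"
    by (simp add: qpoch_def)
  then show ?thesis
    using qpoch_q_nonzero[of n] qpoch_q_nonzero[of "Suc n"]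
    unfolding m inv_qfact_def power_int_of_nat by (simp add: field_simps nat_add_distrib)
qed

lemma inv_qfact_tendsto: "(\<lambda>n. inv_qfact (int n + k)) \<longlonglongrightarrow> 1 / qpoch_inf q q"
proof -
  have "(\<lambda>n. inv_qfact (int n)) \<longlonglongrightarrow> 1 / qpoch_inf q q"
    unfolding inv_qfact_def
    by (simp, intro tendsto_intros qpoch_tendsto qpoch_inf_q_nonzero)
  moreover have "filterlim (\<lambda>n. nat (int n + k)) at_top at_top"
    by (rule filterlim_at_top_mono[OF filterlim_minus_const_nat_at_top[of "nat (- k)"]])
       (intro always_eventually allI, linarith)
  ultimately have "((\<lambda>n. inv_qfact (int (nat (int n + k)))) \<longlongrightarrow> 1 / qpoch_inf q q) sequentially"
    by (rule filterlim_compose)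
  moreover have "eventually (\<lambda>n. inv_qfact (int (nat (int n + k))) = inv_qfact (int n + k)) sequentially"
    using eventually_ge_at_top[of "nat (- k)"] by eventually_elim auto
  ultimately show ?thesis by (rule Lim_transform_eventually)
qed

lemma inv_qfact_bounded: obtains B where "B > 0" "\<And>m. norm (inv_qfact m) \<le> B"
proof -
  have "convergent (\<lambda>n. inv_qfact (int n))"
    using inv_qfact_tendsto[of 0] by (auto simp: convergent_def)
  then have "Bseq (\<lambda>n. inv_qfact (int n))" by (rule convergent_imp_Bseq)
  then obtain B where B: "B > 0" "\<And>n. norm (inv_qfact (int n)) \<le> B"
    by (metis BseqE)
  have "norm (inv_qfact m) \<le> B" for m
    using B(1) B(2)[of "nat m"] by (cases "m < 0") (auto simp: inv_qfact_def)
  with B show ?thesis using that by blast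
qed

text \<open>The finite form of the triple product: the coefficient is the central q-binomial
  coefficient [2n, n+k], and \<open>inv_qfact\<close> kills all terms with |k| > n. Passing to n + 1
  multiplies the product by (1 - x q^n)(1 - q^(n+1)/x); comparing powers of x gives a three-term
  recurrence.\<close>

lemma finite_jacobi_triple:
  assumes x: "x \<noteq> 0"
  shows "((\<lambda>k. theta_coeff q k x * (qpoch q q (2 * n) * inv_qfact (int n + k) * inv_qfact (int n - k)))
           has_sum qpoch x q n * qpoch (q / x) q n) UNIV"
proof (induction n)
  case 0
  have "theta_coeff q k x * (qpoch q q (2 * 0) * inv_qfact (int 0 + k) * inv_qfact (int 0 - k)) =
        (if k = 0 then 1 else 0)" for k
    by (auto simp: inv_qfact_def qpoch_def)
  then show ?case
    by (simp add: qpoch_def) (rule has_sum_finite_neutralI[of "{0}"]; simp)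
next
  case (Suc n)
  define f where "f = (\<lambda>n k. theta_coeff q k x *
    (qpoch q q (2 * n) * inv_qfact (int n + k) * inv_qfact (int n - k)))"
  let ?P = "qpoch x q n * qpoch (q / x) q n"
  have f: "(f n has_sum ?P) UNIV" using Suc by (simp add: f_def)
  have f1: "((\<lambda>k. f n (k - 1)) has_sum ?P) UNIV"
    using has_sum_int_shift[of "f n" "- 1"] f by simp
  have f2: "((\<lambda>k. f n (k + 1)) has_sum ?P) UNIV"
    using has_sum_int_shift[of "f n" 1] f by simp
  have rec: "f (Suc n) k = (1 + q ^ (2 * n + 1)) * f n k + (- x * q ^ n) * f n (k - 1)
               + (- (q ^ (n + 1) / x)) * f n (k + 1)" for k
  proof -
    \<comment> \<open>\<open>A\<close> and \<open>B\<close> carry the largest arguments that occur,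
      so the descending recursion \<open>inv_qfact_rec\<close> expresses all other values as
      multiples of them without any division.\<close>
    define T u v A B where "T = theta_coeff q k x" and "u = q ^ n" and "v = q powi k"
      and "A = inv_qfact (int n + k + 1)" and "B = inv_qfact (int n - k + 1)"
    have v: "v \<noteq> 0" using q0 by (simp add: v_def power_int_not_zero)
    have T1: "theta_coeff q (k + 1) x = - x * v * T"
      by (simp add: theta_coeff_Suc[OF x] T_def v_def)
    have "T = - x * (v / q) * theta_coeff q (k - 1) x"
      using theta_coeff_Suc[OF x, of "k - 1"] q0 by (simp add: T_def v_def power_int_diff)
    then have T2: "theta_coeff q (k - 1) x = - q * T / (x * v)"
      using x v q0 by (simp add: field_simps)
    have A: "inv_qfact (int n + k) = (1 - q * u * v) * A"
      using inv_qfact_rec[of "int n + k + 1"] q0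
      by (simp add: A_def u_def v_def power_int_add mult_ac)
    have A': "inv_qfact (int n + k - 1) = (1 - u * v) * (1 - q * u * v) * A"
      using inv_qfact_rec[of "int n + k"] A q0 by (simp add: u_def v_def power_int_add mult_ac)
    have B: "inv_qfact (int n - k) = (1 - q * u / v) * B"
      using inv_qfact_rec[of "int n - k + 1"] q0
      by (simp add: B_def u_def v_def power_int_add power_int_diff mult_ac)
    have B': "inv_qfact (int n - k - 1) = (1 - u / v) * (1 - q * u / v) * B"
      using inv_qfact_rec[of "int n - k"] B q0 by (simp add: u_def v_def power_int_diff mult_ac)
    have u2: "q ^ (2 * n) = u ^ 2" by (simp add: u_def power_mult[symmetric] mult.commute)
    have "qpoch q q (2 * Suc n) = qpoch q q (Suc (Suc (2 * n)))" by simp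
    also have "\<dots> = qpoch q q (2 * n) * (1 - q * u ^ 2) * (1 - q ^ 2 * u ^ 2)"
      unfolding qpoch_Suc power_Suc u2 power2_eq_square by (simp only: mult_ac)
    finally have Q: "qpoch q q (2 * Suc n) = qpoch q q (2 * n) * (1 - q * u ^ 2) * (1 - q ^ 2 * u ^ 2)" .
    have l: "f (Suc n) k = T * (qpoch q q (2 * n) * (1 - q * u ^ 2) * (1 - q ^ 2 * u ^ 2) * A * B)"
      unfolding f_def Q T_def A_def B_def by (simp add: algebra_simps)
    have r0: "f n k = T * (qpoch q q (2 * n) * ((1 - q * u * v) * A) * ((1 - q * u / v) * B))"
      unfolding f_def A B T_def ..
    have r1: "f n (k - 1) = - q * T / (x * v) * (qpoch q q (2 * n) * ((1 - u * v) * (1 - q * u * v) * A) * B)"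
      unfolding f_def T2 A'[symmetric] B_def by (simp add: algebra_simps)
    have r2: "f n (k + 1) = - x * v * T * (qpoch q q (2 * n) * A * ((1 - u / v) * (1 - q * u / v) * B))"
      unfolding f_def T1 B'[symmetric] A_def by (simp add: algebra_simps)
    have q_eq: "q ^ (2 * n + 1) = q * u ^ 2" "q ^ (n + 1) = q * u"
      using u2 by (simp_all add: u_def)
    show ?thesis
      unfolding l r0 r1 r2 q_eq u_def[symmetric]
      using x v q0 by (simp add: field_simps power2_eq_square)
  qed
  have "((\<lambda>k. (1 + q ^ (2 * n + 1)) * f n k + (- x * q ^ n) * f n (k - 1) + (- (q ^ (n + 1) / x)) * f n (k + 1))
          has_sum (1 + q ^ (2 * n + 1)) * ?P + (- x * q ^ n) * ?P + (- (q ^ (n + 1) / x)) * ?P) UNIV"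
    by (intro has_sum_add has_sum_cmult_right f f1 f2)
  also have "(1 + q ^ (2 * n + 1)) * ?P + (- x * q ^ n) * ?P + (- (q ^ (n + 1) / x)) * ?P =
             qpoch x q (Suc n) * qpoch (q / x) q (Suc n)"
    using x by (simp add: qpoch_def field_simps power_add mult_2_right)
  finally show ?case unfolding rec[symmetric] by (simp add: f_def)
qed

text \<open>Let n tend to infinity in the finite form. The q-binomial coefficients are bounded by E
  B^2 uniformly in n and k and tend to 1/(q;q)_inf, so the limit may be taken termwise.\<close>

lemma jacobi_triple:
  assumes x: "x \<noteq> 0"
  shows "(\<Sum>\<^sub>\<infinity>k. theta_coeff q k x) = theta_j x q"
proof -
  define f where "f = (\<lambda>k n. theta_coeff q k x *
    (qpoch q q (2 * n) * inv_qfact (int n + k) * inv_qfact (int n - k)))"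
  define E where "E = exp (norm q / (1 - norm q))"
  obtain B where B: "B > 0" "\<And>m. norm (inv_qfact m) \<le> B" using inv_qfact_bounded by blast
  have "(\<lambda>n. \<Sum>\<^sub>\<infinity>k. f k n) \<longlonglongrightarrow>
        (\<Sum>\<^sub>\<infinity>k. theta_coeff q k x * (qpoch_inf q q * (1 / qpoch_inf q q) * (1 / qpoch_inf q q)))"
  proof (rule infsum_tendsto)
    show "(\<lambda>k. norm (theta_coeff q k x) * (E * B * B)) summable_on UNIV"
      by (intro summable_on_cmult_left abs_summable_theta_coeff[OF x])
    show "norm (f k n) \<le> norm (theta_coeff q k x) * (E * B * B)" for k n
      unfolding f_def norm_mult E_def using B
      by (intro mult_left_mono mult_mono norm_qpoch_le) (auto simp: norm_qpoch_le)
    have "(\<lambda>n. qpoch q q (2 * n)) \<longlonglongrightarrow> qpoch_inf q q"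
      by (rule filterlim_compose[OF qpoch_tendsto mult_nat_left_at_top]) simp
    then show "f k \<longlonglongrightarrow> theta_coeff q k x * (qpoch_inf q q * (1 / qpoch_inf q q) * (1 / qpoch_inf q q))" for k
      unfolding f_def using inv_qfact_tendsto[of k] inv_qfact_tendsto[of "- k"]
      by (intro tendsto_mult tendsto_const) auto
  qed
  also have "(\<lambda>n. \<Sum>\<^sub>\<infinity>k. f k n) = (\<lambda>n. qpoch x q n * qpoch (q / x) q n)"
    using finite_jacobi_triple[OF x] by (auto simp: f_def intro: infsumI)
  finally have "(\<lambda>n. qpoch x q n * qpoch (q / x) q n) \<longlonglongrightarrow>
      (\<Sum>\<^sub>\<infinity>k. theta_coeff q k x) * (1 / qpoch_inf q q)"
    using qpoch_inf_q_nonzero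
    by (simp add: infsum_cmult_left summable_theta_coeff[OF x] divide_inverse)
  moreover have "(\<lambda>n. qpoch x q n * qpoch (q / x) q n) \<longlonglongrightarrow> qpoch_inf x q * qpoch_inf (q / x) q"
    by (intro tendsto_mult qpoch_tendsto)
  ultimately have "(\<Sum>\<^sub>\<infinity>k. theta_coeff q k x) * (1 / qpoch_inf q q) = qpoch_inf x q * qpoch_inf (q / x) q"
    by (rule LIMSEQ_unique)
  then show ?thesis
    using qpoch_inf_q_nonzero by (simp add: theta_j_def field_simps)
qed

subsection \<open>Appell--Lerch sums\<close>

lemma q_powi_ne_1:
  assumes "r \<noteq> 0" shows "q powi r \<noteq> 1"
proof -
  have *: "q ^ n \<noteq> 1" if "n > 0" for n
  proof
    assume "q ^ n = 1"
    then have "norm q ^ n = 1" by (metis norm_one norm_power)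
    moreover have "norm q ^ n < 1" using q0 q1 that by (intro power_less_one_iff[THEN iffD2]) auto
    ultimately show False by simp
  qed
  show ?thesis
  proof (cases r rule: int_cases2)
    case (nonneg n)
    then show ?thesis using *[of n] assms by simp
  next
    case (nonpos n)
    then show ?thesis using *[of n] assms by (simp add: power_int_minus)
  qed
qed

section \<open>Zeros of theta functions and the value of the regularised series at its pole\<close>

lemma countable_theta_zeros:
  assumes "c \<noteq> 0" shows "countable {x. x \<noteq> 0 \<and> theta_j (c * x) q = 0}"
proof (rule countable_subset)
  show "{x. x \<noteq> 0 \<and> theta_j (c * x) q = 0} \<subseteq> range (\<lambda>r::int. 1 / (q powi r * c))"
  proof clarify
    fix x assume "x \<noteq> 0" "theta_j (c * x) q = 0"
    then obtain r :: int where r: "q powi r * (c * x) = 1"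
      using theta_j_eq_0_iff[of "c * x"] assms by auto
    then have "x = 1 / (q powi r * c)"
      using assms q0 by (simp add: field_simps power_int_not_zero)
    then show "x \<in> range (\<lambda>r::int. 1 / (q powi r * c))" by blast
  qed
qed auto

lemma theta_j_eq_0_shift_iff:
  "w \<noteq> 0 \<Longrightarrow> theta_j (q powi r * w) q = 0 \<longleftrightarrow> theta_j w q = 0"
  using theta_j_shift_int[of w r] theta_coeff_nonzero[of w r] by auto

lemma theta_reg_1_nonzero: "theta_reg 1 q \<noteq> 0"
  using qpoch_inf_q_nonzero by (simp add: theta_reg_def)

lemma theta_cut_1: "theta_cut q r 1 = (if r = 0 then theta_reg 1 q else 0)"
  using theta_j_eq_cut[of 1 r] q_powi_ne_1[of r] by (auto simp: theta_cut_def)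

text \<open>At y = 1 only the term r = 0 survives, and its coefficient is 1 whatever z is. This
  value takes the place of a residue when the parameter z is changed.\<close>

lemma lerch_reg_1: "lerch_reg q 1 z = theta_reg 1 q"
  unfolding lerch_reg_def theta_cut_1
  by (rule infsumI) (rule has_sum_finite_neutralI[of "{0}"]; simp)

lemma lerch_reg_eq:
  assumes "y \<noteq> 0" "theta_j y q \<noteq> 0"
  shows "lerch_reg q y z = theta_j y q * lerch q y z"
proof -
  have "theta_coeff q r z * theta_cut q r y = theta_j y q * (theta_coeff q r z / (1 - q powi r * y))" for r
  proof -
    have "1 - q powi r * y \<noteq> 0" using theta_j_eq_cut[OF assms(1), of r] assms(2) by auto
    then show ?thesis by (simp add: theta_j_eq_cut[OF assms(1), of r])
  qed
  then show ?thesis by (simp only: lerch_reg_def lerch_def infsum_cmult_right')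
qed

text \<open>With s = r + 1 the s-th pole factor for y reappears, and the numerator gains q^(-s) up
  to constants. Writing q^(-s) = y + q^(-s) (1 - q^s y) splits the term: the first part gives back
  the series, the second cancels the pole factor and leaves a theta series at z/q. These are the two
  summands of \<open>g\<close>.\<close>

lemma lerch_reg_q_left:
  assumes y: "y \<noteq> 0" and z: "z \<noteq> 0"
  shows "lerch_reg q (q * y) z = - theta_j y q * theta_j z q / y + q / z * lerch_reg q y z"
proof -
  define g where "g = (\<lambda>s. q / z * (theta_coeff q s z * theta_cut q s y)
                          + q / (y * z) * theta_j y q * theta_coeff q s (z / q))"
  have zq: "z / q \<noteq> 0" using z q0 by simp
  have "theta_coeff q r z * theta_cut q r (q * y) = g (r + 1)" for r
  proof -
    define v where "v = q powi r"
    have v: "v \<noteq> 0" "q powi (r + 1) = q * v" using q0 by (simp_all add: v_def power_int_not_zero power_int_add)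
    have "theta_coeff q (r + 1) z = q * v * theta_coeff q (r + 1) (z / q)"
      using theta_coeff_mult[of "r + 1" "z / q"] q0 v by simp
    then have 1: "theta_coeff q (r + 1) (z / q) = - z / q * theta_coeff q r z"
    proof -
      have "v * (q * theta_coeff q (r + 1) (z / q)) = v * (- z * theta_coeff q r z)"
        using \<open>theta_coeff q (r + 1) z = _\<close> theta_coeff_Suc[OF z, of r]
        by (simp add: v_def[symmetric] mult_ac)
      then have "q * theta_coeff q (r + 1) (z / q) = - z * theta_coeff q r z"
        using mult_left_cancel[OF v(1)] by blast
      then show ?thesis using q0 by (simp add: field_simps)
    qed
    have 2: "theta_cut q r (q * y) = - theta_cut q (r + 1) y / y"
      using y q0 v unfolding theta_cut_def theta_coeff_mult theta_coeff_Suc[OF y] v_def[symmetric]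
      by (simp add: mult_ac)
    have 3: "theta_j y q = (1 - q * v * y) * theta_cut q (r + 1) y"
      using theta_j_eq_cut[OF y, of "r + 1"] v by simp
    show ?thesis
      unfolding g_def 1 2 3 theta_coeff_Suc[OF z] v_def[symmetric]
      using y z q0 v by (simp add: field_simps)
  qed
  then have "lerch_reg q (q * y) z = (\<Sum>\<^sub>\<infinity>s. g s)"
    by (simp add: lerch_reg_def infsum_int_shift)
  also have "\<dots> = q / z * lerch_reg q y z + q / (y * z) * theta_j y q * theta_j (z / q) q"
    unfolding g_def lerch_reg_def jacobi_triple[OF zq, symmetric]
    by (subst infsum_add)
       (auto intro!: summable_on_cmult_right summable_lerch_reg summable_theta_coeff y z zq
             simp only: infsum_cmult_right')
  also have "theta_j (z / q) q = - z / q * theta_j z q"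
    using theta_j_shift[OF zq] q0 z by (simp add: field_simps)
  finally show ?thesis using y z q0 by (simp add: field_simps)
qed

text \<open>Replacing z by q z multiplies the r-th term by q^r = (1 - (1 - q^r y))/y; the second
  part cancels the pole factor and sums to a theta function.\<close>

lemma lerch_reg_q_right:
  assumes y: "y \<noteq> 0" and z: "z \<noteq> 0"
  shows "lerch_reg q y (q * z) = (lerch_reg q y z - theta_j y q * theta_j z q) / y"
proof -
  have "theta_coeff q r (q * z) * theta_cut q r y =
        1 / y * (theta_coeff q r z * theta_cut q r y) + (- theta_j y q / y) * theta_coeff q r z" for r
    unfolding theta_coeff_mult theta_j_eq_cut[OF y, of r] using y by (simp add: field_simps)
  then have "lerch_reg q y (q * z) = 1 / y * lerch_reg q y z + (- theta_j y q / y) * theta_j z q"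
    unfolding lerch_reg_def jacobi_triple[OF z, symmetric]
    by (simp only:, subst infsum_add)
       (auto intro!: summable_on_cmult_right summable_lerch_reg summable_theta_coeff
             simp only: infsum_cmult_right' y z not_False_eq_True)
  then show ?thesis using y by (simp add: field_simps)
qed

text \<open>Shifting the index by one turns the numerator into -w/x times
  \<open>theta_coeff q r z\<close> with w = q^r x z, and -w/(1 - w) = 1 - 1/(1 - w) separates a
  theta series from \<open>lerch\<close>.\<close>

lemma appell_m_eq_lerch:
  assumes x: "x \<noteq> 0" and z: "z \<noteq> 0" and nz: "theta_j z q \<noteq> 0" "theta_j (x * z) q \<noteq> 0"
  shows "appell_m x q z = (1 - lerch q (x * z) z / theta_j z q) / x"
proof -
  define g where "g = (\<lambda>r::int. (-1) powi r * q powi (r * (r - 1) div 2) * z powi r / (1 - q powi (r - 1) * x * z))"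
  have xz: "x * z \<noteq> 0" using x z by simp
  have g: "g (r + 1) = 1 / x * theta_coeff q r z + (- 1 / x) * (theta_coeff q r z / (1 - q powi r * (x * z)))" for r
  proof -
    define w where "w = q powi r * (x * z)"
    have "g (r + 1) = theta_coeff q (r + 1) z / (1 - w)"
      by (simp add: g_def theta_coeff_def w_def mult_ac)
    also have "theta_coeff q (r + 1) z = - w / x * theta_coeff q r z"
      unfolding theta_coeff_Suc[OF z] using x by (simp add: w_def)
    finally have "g (r + 1) = - w / x * theta_coeff q r z / (1 - w)" .
    moreover have "1 - w \<noteq> 0"
      using theta_j_eq_cut[OF xz, of r] nz by (auto simp: w_def)
    ultimately show ?thesis
      unfolding w_def[symmetric] using x by (simp add: field_simps)
  qed
  have "(\<lambda>r. 1 / theta_j (x * z) q * (theta_coeff q r z * theta_cut q r (x * z))) summable_on UNIV"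
    using xz z by (intro summable_on_cmult_right summable_lerch_reg)
  moreover have "1 / theta_j (x * z) q * (theta_coeff q r z * theta_cut q r (x * z))
                   = theta_coeff q r z / (1 - q powi r * (x * z))" for r
    using theta_j_eq_cut[OF xz, of r] nz by auto
  ultimately have sm: "(\<lambda>r. theta_coeff q r z / (1 - q powi r * (x * z))) summable_on UNIV"
    by simp
  have "(\<Sum>\<^sub>\<infinity>r. g r) = (\<Sum>\<^sub>\<infinity>r. g (r + 1))" by (rule infsum_int_shift[symmetric])
  also have "\<dots> = 1 / x * theta_j z q + (- 1 / x) * lerch q (x * z) z"
    unfolding g lerch_def jacobi_triple[OF z, symmetric]
    by (subst infsum_add) (auto intro!: summable_on_cmult_right sm summable_theta_coeff z
             simp only: infsum_cmult_right')
  finally show ?thesis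
    unfolding appell_m_def g_def[symmetric] using nz x by (simp add: field_simps)
qed

text \<open>The points q^r/c are all the zeros of j(c x;q), and they are simple. Where f vanishes
  too, the singularities of the quotient are removable.\<close>

lemma theta_division:
  assumes hol: "f holomorphic_on - {0}" and c: "c \<noteq> 0"
    and zero: "\<And>r::int. f (q powi r / c) = 0"
  shows "\<exists>g. g holomorphic_on - {0} \<and> (\<forall>x. x \<noteq> 0 \<longrightarrow> f x = g x * theta_j (c * x) q)"
proof -
  \<comment> \<open>Defined as a limit, the quotient is one global function that agrees with every
    local continuation.\<close>
  define g where "g = (\<lambda>x. Lim (at x) (\<lambda>w. f w / theta_j (c * w) q))"
  have local: "\<exists>e \<psi>. e > 0 \<and> \<psi> holomorphic_on ball p e \<and> ball p e \<subseteq> - {0} \<and> f p = \<psi> p * theta_j (c * p) q \<and>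
          (\<forall>w\<in>ball p e - {p}. f w / theta_j (c * w) q = \<psi> w)" if p: "p \<noteq> 0" for p
  proof -
    define S where "S = - {0 :: complex}"
    have S: "open S" "p \<in> S" using p by (auto simp: S_def)
    show ?thesis
    proof (cases "theta_j (c * p) q = 0")
      case False
      have h: "(\<lambda>w. theta_j (c * w) q) holomorphic_on S"
        unfolding S_def using c by (intro holomorphic_theta_j holomorphic_intros) auto
      obtain e where e: "e > 0" "ball p e \<subseteq> S" "\<And>w. w \<in> ball p e \<Longrightarrow> theta_j (c * w) q \<noteq> 0"
        using nonzero_ball[OF S(1) h S(2) False] by blast
      have "(\<lambda>w. f w / theta_j (c * w) q) holomorphic_on ball p e"
        using e hol h unfolding S_def by (intro holomorphic_on_divide) (auto intro: holomorphic_on_subset)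
      with e False show ?thesis unfolding S_def
        by (intro exI[of _ e] exI[of _ "\<lambda>w. f w / theta_j (c * w) q"]) simp
    next
      case True
      then obtain r :: int where r: "q powi r * (c * p) = 1"
        using theta_j_eq_0_iff[of "c * p"] c p by auto
      have p_eq: "p = q powi (- r) / c"
        using r c q0 by (simp add: power_int_minus field_simps)
      have fp: "f p = 0" using zero[of "- r"] by (simp add: p_eq)
      define F where "F = (\<lambda>w. if w = p then deriv f p else (f w - f p) / (w - p))"
      have F: "F holomorphic_on S"
        unfolding F_def using pole_lemma[OF hol, of p] p by (simp add: S_def interior_open open_Compl)
      \<comment> \<open>The cofactor in j(c w;q) = h(w) (w - p). It is nonzero at p because
        \<open>theta_reg 1 q\<close> is, so the zero is simple and \<open>F / h\<close> continues
        the quotient.\<close>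
      define h where "h = (\<lambda>w. - (q powi r * c) * theta_cut q r (c * w))"
      have h: "h holomorphic_on S"
        unfolding h_def theta_cut_def theta_coeff_def S_def using c q0
        by (intro holomorphic_intros holomorphic_theta_reg) (auto simp: power_int_not_zero)
      have hp: "h p \<noteq> 0"
        using r c p q0 theta_coeff_nonzero[of "c * p" r] theta_reg_1_nonzero
        unfolding h_def theta_cut_def by (simp add: power_int_not_zero)
      obtain e where e: "e > 0" "ball p e \<subseteq> S" "\<And>w. w \<in> ball p e \<Longrightarrow> h w \<noteq> 0"
        using nonzero_ball[OF S(1) h S(2) hp] by blast
      have "(\<lambda>w. F w / h w) holomorphic_on ball p e"
        using e F h by (intro holomorphic_on_divide) (auto intro: holomorphic_on_subset)
      moreover have "f w / theta_j (c * w) q = F w / h w" if w: "w \<in> ball p e - {p}" for w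
      proof -
        have w0: "w \<noteq> 0" "w \<noteq> p" using w e by (auto simp: S_def)
        have "theta_j (c * w) q = (1 - q powi r * (c * w)) * theta_cut q r (c * w)"
          using w0 c by (intro theta_j_eq_cut) auto
        also have "1 - q powi r * (c * w) = - (q powi r * c) * (w - p)"
          using r by (simp add: algebra_simps)
        finally have "theta_j (c * w) q = h w * (w - p)" by (simp add: h_def mult_ac)
        then show ?thesis using w0 by (simp add: F_def fp)
      qed
      ultimately show ?thesis using e fp True unfolding S_def
        by (intro exI[of _ e] exI[of _ "\<lambda>w. F w / h w"]) simp
    qed
  qed
  have g_eq: "g x = \<psi> x" if "\<psi> holomorphic_on ball p e" "x \<in> ball p e"
    "\<forall>w\<in>ball p e - {p}. f w / theta_j (c * w) q = \<psi> w" for x p e \<psi>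
  proof -
    have "isCont \<psi> x"
      using that holomorphic_on_imp_continuous_on continuous_on_eq_continuous_at open_ball by blast
    then have "(\<psi> \<longlongrightarrow> \<psi> x) (at x)" by (simp add: isCont_def)
    moreover have "eventually (\<lambda>w. w \<in> ball p e) (at x)"
      using that by (intro eventually_at_in_open') auto
    then have "eventually (\<lambda>w. \<psi> w = f w / theta_j (c * w) q) (at x)"
      using eventually_neq_at_within[of p x UNIV]
    proof eventually_elim
      case (elim w)
      then show ?case using that(3) by simp
    qed
    ultimately have "((\<lambda>w. f w / theta_j (c * w) q) \<longlongrightarrow> \<psi> x) (at x)"
      by (rule Lim_transform_eventually)
    then show ?thesis unfolding g_def by (intro tendsto_Lim) auto
  qed
  have "g field_differentiable (at p)" "f p = g p * theta_j (c * p) q" if p: "p \<noteq> 0" for p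
  proof -
    obtain e \<psi> where e: "e > 0" "\<psi> holomorphic_on ball p e" "f p = \<psi> p * theta_j (c * p) q"
      "\<forall>w\<in>ball p e - {p}. f w / theta_j (c * w) q = \<psi> w"
      using local[OF p] by blast
    have eq: "g x = \<psi> x" if "x \<in> ball p e" for x using g_eq[OF e(2) that e(4)] .
    then show "f p = g p * theta_j (c * p) q" using e by simp
    have "g holomorphic_on ball p e" using e(2) eq holomorphic_transform by metis
    then show "g field_differentiable (at p)"
      using e(1) by (intro holomorphic_on_imp_differentiable_at[of _ "ball p e"]) auto
  qed
  then show ?thesis
    by (intro exI[of _ g]) (auto simp: holomorphic_on_def field_differentiable_at_within)
qed

subsection \<open>Changing the auxiliary parameter\<close>

text \<open>The unit \<open>s\<close> admits both uses: s = -1, k = 1 for the change of parameter,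
  and s = 1, k = 2 for the bilateral series.\<close>

lemma quasi_periodic_imp_zero:
  assumes hol: "f holomorphic_on - {0}" and k: "k > 0" and s: "norm s = 1"
    and per: "\<And>x. x \<noteq> 0 \<Longrightarrow> f (q * x) = s * q * x ^ k * f x" and x: "x \<noteq> 0"
  shows "f x = 0"
proof -
  have "\<exists>c. \<forall>x. x \<noteq> 0 \<longrightarrow> f x = c"
  proof (rule bounded_imp_constant_punctured[OF hol q0 q1])
    fix x :: complex assume x: "x \<noteq> 0" "norm x \<le> 1"
    have "norm (f (q * x)) = (norm q * norm x ^ k) * norm (f x)"
      using per[OF x(1)] s by (simp add: norm_mult norm_power)
    also have "\<dots> \<le> 1 * norm (f x)"
      using x q1 by (intro mult_right_mono mult_le_one power_le_one) auto
    finally show "norm (f (q * x)) \<le> norm (f x)" by simp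
  next
    fix x :: complex assume x: "norm x \<ge> 1"
    then have "x \<noteq> 0" by auto
    then have "f x = s * q * (x / q) ^ k * f (x / q)"
      using per[of "x / q"] q0 by simp
    then have "norm (f x) = (norm q * (norm x / norm q) ^ k) * norm (f (x / q))"
      using s by (simp add: norm_mult norm_power norm_divide)
    also have "\<dots> \<ge> 1 * norm (f (x / q))"
    proof (rule mult_right_mono)
      have ge: "norm x / norm q \<ge> 1 / norm q" using x q0 by (simp add: divide_right_mono)
      have "1 / norm q \<ge> 1" using q0 q1 by simp
      with ge have ge1: "norm x / norm q \<ge> 1" by linarith
      have "norm x / norm q \<le> (norm x / norm q) ^ k"
        using ge1 k by (intro self_le_power) auto
      with ge have "1 / norm q \<le> (norm x / norm q) ^ k" by linarith
      then show "1 \<le> norm q * (norm x / norm q) ^ k" using q0 by (simp add: field_simps)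
    qed auto
    finally show "norm (f (x / q)) \<le> norm (f x)" by simp
  qed
  then obtain c where c: "\<And>x. x \<noteq> 0 \<Longrightarrow> f x = c" by blast
  \<comment> \<open>The equation at x = 1 excludes nonzero constants, since |s q| < 1.\<close>
  have "c = s * q * c" using per[of 1] c[of 1] c[of q] q0 by simp
  moreover have "s * q \<noteq> 1"
    using s q1 by (metis norm_mult norm_one mult_1 less_irrefl)
  ultimately have "c = 0" by (metis mult_cancel_right1 mult.commute)
  then show ?thesis using c x by simp
qed

text \<open>The cross products are arranged so that the inhomogeneous terms of
  \<open>lerch_reg_q_left\<close> cancel between them. The hypothesis on z1/z0 keeps the orbits of
  1/z0 and 1/z1 disjoint, so the zeros on one survive division by the theta function of the
  other.\<close>

lemma lerch_reg_two_variable: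
  assumes z0: "z0 \<noteq> 0" and z1: "z1 \<noteq> 0" and nz: "theta_j (z1 / z0) q \<noteq> 0" and x: "x \<noteq> 0"
  shows "theta_j z1 q * theta_j (x * z1) q * lerch_reg q (x * z0) z0 -
         theta_j z0 q * theta_j (x * z0) q * lerch_reg q (x * z1) z1 =
         x * z0 * theta_reg 1 q * theta_j (z1 / z0) q * theta_j (x * z0 * z1) q"
proof -
  define E where "E = (\<lambda>x. theta_j z1 q * theta_j (x * z1) q * lerch_reg q (x * z0) z0 -
         theta_j z0 q * theta_j (x * z0) q * lerch_reg q (x * z1) z1 -
         x * z0 * theta_reg 1 q * theta_j (z1 / z0) q * theta_j (x * z0 * z1) q)"
  have holE: "E holomorphic_on - {0}"
    unfolding E_def using z0 z1
    by (intro holomorphic_intros holomorphic_theta_j holomorphic_lerch_reg) auto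
  have E_q: "E (q * x) = - (q / (x * z0 * z1)) * E x" if x: "x \<noteq> 0" for x
  proof -
    have th: "theta_j (q * x * z) q = - theta_j (x * z) q / (x * z)" if "z \<noteq> 0" for z
      using theta_j_shift[of "x * z"] x that by (simp add: mult.assoc)
    have le: "lerch_reg q (q * x * z) z = - theta_j (x * z) q * theta_j z q / (x * z) + q / z * lerch_reg q (x * z) z"
      if "z \<noteq> 0" for z
      using lerch_reg_q_left[of "x * z" z] x that by (simp add: mult.assoc)
    have th2: "theta_j (q * x * z0 * z1) q = - theta_j (x * z0 * z1) q / (x * z0 * z1)"
      using theta_j_shift[of "x * z0 * z1"] x z0 z1 by (simp add: mult.assoc)
    show ?thesis
      unfolding E_def th[OF z0] th[OF z1] le[OF z0] le[OF z1] th2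
      using x z0 z1 by (simp add: field_simps)
  qed
  have orbit: "E (q powi r * p) = 0" if "E p = 0" "p \<noteq> 0" for r p
  proof (induction r rule: int_shift_induct)
    case (2 r)
    have "q powi r * p \<noteq> 0" using q0 that by (simp add: power_int_not_zero)
    then show ?case
      using E_q[of "q powi r * p"] q0 z0 z1 by (simp add: power_int_add mult_ac)
  qed (use that in simp)
  have "theta_j (z0 / z1) q = - (z0 / z1) * theta_j (z1 / z0) q"
    using theta_j_inverse[of "z1 / z0"] z0 z1 by (simp add: field_simps)
  \<comment> \<open>At each point one cross product vanishes with its theta factor and
    \<open>lerch_reg_1\<close> evaluates the other; at 1/z1 the match with the right-hand side needs
    the inversion formula.\<close>
  then have "E (1 / z0) = 0" "E (1 / z1) = 0" and nz': "theta_j (z0 / z1) q \<noteq> 0"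
    using z0 z1 nz unfolding E_def by (simp_all add: lerch_reg_1)
  then have orb0: "E (q powi r / z0) = 0" and orb1: "E (q powi r / z1) = 0" for r
    using orbit[of "1 / z0" r] orbit[of "1 / z1" r] z0 z1 by simp_all
  obtain g where g: "g holomorphic_on - {0}" "\<And>x. x \<noteq> 0 \<Longrightarrow> E x = g x * theta_j (z0 * x) q"
    using theta_division[OF holE z0 orb0] by blast
  have "g (q powi r / z1) = 0" for r
    using g(2)[of "q powi r / z1"] orb1[of r] theta_j_eq_0_shift_iff[of "z0 / z1" r] nz' z0 z1 q0
    by (auto simp: power_int_not_zero mult_ac)
  then obtain d where d: "d holomorphic_on - {0}" "\<And>x. x \<noteq> 0 \<Longrightarrow> g x = d x * theta_j (z1 * x) q"
    using theta_division[OF g(1) z1] by blast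
  have E_d: "E x = d x * theta_j (z1 * x) q * theta_j (z0 * x) q" if "x \<noteq> 0" for x
    using g(2) d(2) that by simp
  \<comment> \<open>The multiplier -q/(x z0 z1) of \<open>E\<close> divided by the multiplier 1/(x^2
    z0 z1) of the two theta factors is -q x.\<close>
  have "d (q * x) + q * x * d x = 0" if x: "x \<noteq> 0" for x
  proof (rule vanish_off_countable[where f = "\<lambda>x. d (q * x) + q * x * d x"])
    show "(\<lambda>x. d (q * x) + q * x * d x) holomorphic_on - {0}"
      using d(1) q0
      by (intro holomorphic_intros holomorphic_on_compose_gen[OF _ d(1), unfolded o_def]) auto
    show "countable ({x. x \<noteq> 0 \<and> theta_j (z0 * x) q = 0} \<union> {x. x \<noteq> 0 \<and> theta_j (z1 * x) q = 0})"
      using countable_theta_zeros z0 z1 by simp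
  next
    fix x :: complex
    assume x: "x \<noteq> 0" and "x \<notin> {x. x \<noteq> 0 \<and> theta_j (z0 * x) q = 0} \<union> {x. x \<noteq> 0 \<and> theta_j (z1 * x) q = 0}"
    then have t: "theta_j (z0 * x) q \<noteq> 0" "theta_j (z1 * x) q \<noteq> 0" by auto
    have th: "theta_j (z * (q * x)) q = - theta_j (z * x) q / (x * z)" if "z \<noteq> 0" for z
      using theta_j_shift[of "z * x"] x that by (simp add: mult_ac)
    have "d (q * x) * (theta_j (z1 * x) q * theta_j (z0 * x) q / (x ^ 2 * z0 * z1)) = E (q * x)"
      using E_d[of "q * x"] x q0 z0 z1 unfolding th[OF z0] th[OF z1]
      by (simp add: field_simps power2_eq_square)
    also have "\<dots> = - (q * x * d x) * (theta_j (z1 * x) q * theta_j (z0 * x) q / (x ^ 2 * z0 * z1))"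
      unfolding E_q[OF x] E_d[OF x] using x z0 z1 by (simp add: field_simps power2_eq_square)
    finally have "d (q * x) = - (q * x * d x)"
      using t x z0 z1 by (subst (asm) mult_right_cancel) auto
    then show "d (q * x) + q * x * d x = 0" by simp
  qed (fact x)
  then have "d (q * x) = (- 1) * q * x ^ 1 * d x" if "x \<noteq> 0" for x
    using that by (simp add: eq_neg_iff_add_eq_0)
  from quasi_periodic_imp_zero[OF d(1) _ _ this x] have "d x = 0" by simp
  then have "E x = 0" using E_d[OF x] by simp
  then show ?thesis by (simp add: E_def)
qed

text \<open>The common term 1/x of \<open>appell_m_eq_lerch\<close> drops out of the difference. The
  factor \<open>theta_reg 1 q\<close> is the cube of (q;q)_inf.\<close>

lemma appell_m_diff:
  assumes x: "x \<noteq> 0" and z: "z0 \<noteq> 0" "z1 \<noteq> 0"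
    and nz: "theta_j z0 q \<noteq> 0" "theta_j z1 q \<noteq> 0" "theta_j (x * z0) q \<noteq> 0" "theta_j (x * z1) q \<noteq> 0"
      "theta_j (z1 / z0) q \<noteq> 0"
  shows "appell_m x q z1 - appell_m x q z0 =
    z0 * theta_reg 1 q * theta_j (z1 / z0) q * theta_j (x * z0 * z1) q /
    (theta_j z0 q * theta_j z1 q * theta_j (x * z0) q * theta_j (x * z1) q)"
proof -
  have xz: "x * z0 \<noteq> 0" "x * z1 \<noteq> 0" using x z by auto
  define A B where "A = lerch q (x * z0) z0" and "B = lerch q (x * z1) z1"
  have "theta_j z1 q * theta_j (x * z1) q * (theta_j (x * z0) q * A) -
         theta_j z0 q * theta_j (x * z0) q * (theta_j (x * z1) q * B) =
         x * z0 * theta_reg 1 q * theta_j (z1 / z0) q * theta_j (x * z0 * z1) q"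
    unfolding A_def B_def
    using lerch_reg_two_variable[OF z nz(5) x] nz xz by (simp add: lerch_reg_eq)
  then have "(A / theta_j z0 q - B / theta_j z1 q) / x =
    z0 * theta_reg 1 q * theta_j (z1 / z0) q * theta_j (x * z0 * z1) q /
    (theta_j z0 q * theta_j z1 q * theta_j (x * z0) q * theta_j (x * z1) q)"
    using nz x by (simp add: divide_simps) (simp add: algebra_simps)
  also have "(A / theta_j z0 q - B / theta_j z1 q) / x = appell_m x q z1 - appell_m x q z0"
    using nz x z by (simp add: appell_m_eq_lerch A_def B_def field_simps)
  finally show ?thesis .
qed

subsection \<open>The bilateral series\<close>

lemma norm_qpoch_inf_le: "norm (qpoch_inf x q) \<le> exp (norm x / (1 - norm q))"
  by (rule tendsto_upperbound[OF tendsto_norm[OF qpoch_tendsto]]) (auto simp: norm_qpoch_le)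

lemma norm_upper_term_le:
  "norm (upper_term q x n) \<le>
     exp (norm (1 / x) / (1 - norm q)) * exp (norm (q * x) / (1 - norm q)) * norm q * norm q ^ n"
  unfolding upper_term_def norm_mult[of "_ * _"] norm_mult[of "qpoch _ _ _"] norm_power power_add power_one_right
  unfolding mult.assoc[of _ "norm q" "norm q ^ n"] mult.commute[of "norm q ^ n"]
  by (intro mult_mono norm_qpoch_le mult_nonneg_nonneg) (auto simp: norm_mult norm_power mult.commute)

lemma norm_lower_reg_le:
  "norm (lower_reg q x n) \<le>
     exp (norm x / (1 - norm q)) * exp (norm (q / x) / (1 - norm q)) * norm q ^ n"
proof -
  have mono: "exp (norm (w * q ^ m) / (1 - norm q)) \<le> exp (norm w / (1 - norm q))" for w m
    using q1 by (auto simp: norm_mult norm_power divide_simps intro!: mult_left_le power_le_one)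
  have "n \<le> n\<^sup>2" by (cases n) (auto simp: power2_eq_square)
  then have "norm q ^ (n\<^sup>2) \<le> norm q ^ n" using q1 by (intro power_decreasing) auto
  then have "norm (lower_reg q x n) \<le> norm q ^ n *
      (exp (norm x / (1 - norm q)) * exp (norm (q / x) / (1 - norm q)))"
    unfolding lower_reg_def norm_mult[of "_ ^ _"] norm_mult[of "qpoch_inf _ _"] norm_power
    by (intro mult_mono order_trans[OF norm_qpoch_inf_le mono]) auto
  then show ?thesis by (simp add: mult_ac)
qed

lemma holomorphic_upper: "(\<lambda>x. \<Sum>n. upper_term q x n) holomorphic_on - {0}"
proof (rule holomorphic_suminf)
  show "(\<lambda>x. upper_term q x n) holomorphic_on - {0}" for n
    unfolding upper_term_def qpoch_def by (intro holomorphic_intros) auto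
next
  fix R :: real assume R: "R > 1"
  let ?C = "exp (R / (1 - norm q))"
  have "norm (upper_term q x n) \<le> (?C * ?C * norm q) * norm q ^ n" if "x \<in> annulus R" for x n
  proof -
    have x: "norm x \<le> R" "norm (1 / x) \<le> R"
      using that inverse_in_annulus[OF R that] by (auto simp: annulus_def)
    have "norm (q * x) \<le> 1 * R" unfolding norm_mult using x q1 by (intro mult_mono) auto
    then have "exp (norm (1 / x) / (1 - norm q)) \<le> ?C" "exp (norm (q * x) / (1 - norm q)) \<le> ?C"
      using x q1 by (auto intro!: divide_right_mono)
    then have "exp (norm (1 / x) / (1 - norm q)) * exp (norm (q * x) / (1 - norm q)) * norm q * norm q ^ n
                 \<le> ?C * ?C * norm q * norm q ^ n"
      by (intro mult_right_mono mult_mono) auto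
    with norm_upper_term_le[of x n] show ?thesis by linarith
  qed
  then show "\<exists>M. summable M \<and> (\<forall>n. \<forall>x\<in>annulus R. norm (upper_term q x n) \<le> M n)"
    using summable_q[of "?C * ?C * norm q"] by blast
qed

lemma holomorphic_lower: "(\<lambda>x. \<Sum>n. lower_reg q x n) holomorphic_on - {0}"
proof (rule holomorphic_suminf)
  show "(\<lambda>x. lower_reg q x n) holomorphic_on - {0}" for n
    unfolding lower_reg_def by (intro holomorphic_intros holomorphic_qpoch_inf) auto
next
  fix R :: real assume R: "R > 1"
  let ?C = "exp (R / (1 - norm q))"
  have "norm (lower_reg q x n) \<le> (?C * ?C) * norm q ^ n" if "x \<in> annulus R" for x n
  proof -
    have x: "norm x \<le> R" "norm (1 / x) \<le> R"
      using that inverse_in_annulus[OF R that] by (auto simp: annulus_def)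
    have "norm (q * (1 / x)) \<le> 1 * R" unfolding norm_mult using x q1 by (intro mult_mono) auto
    then have "exp (norm x / (1 - norm q)) \<le> ?C" "exp (norm (q / x) / (1 - norm q)) \<le> ?C"
      using x q1 by (auto intro!: divide_right_mono)
    then have "exp (norm x / (1 - norm q)) * exp (norm (q / x) / (1 - norm q)) * norm q ^ n
                 \<le> ?C * ?C * norm q ^ n"
      by (intro mult_right_mono mult_mono) auto
    with norm_lower_reg_le[of x n] show ?thesis by linarith
  qed
  then show "\<exists>M. summable M \<and> (\<forall>n. \<forall>x\<in>annulus R. norm (lower_reg q x n) \<le> M n)"
    using summable_q[of "?C * ?C"] by blast
qed

lemma summable_upper: "summable (upper_term q x)"
  by (rule summable_comparison_test'[OF summable_q norm_upper_term_le])

lemma summable_lower_reg: "summable (lower_reg q x)"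
  by (rule summable_comparison_test'[OF summable_q norm_lower_reg_le])

lemma lower_term_eq_reg:
  assumes "theta_j x q \<noteq> 0"
  shows "lower_term q x n = qpoch_inf q q / theta_j x q * lower_reg q x n"
proof -
  have "theta_j x q = qpoch x q (n + 1) * qpoch_inf (x * q ^ (n + 1)) q *
          (qpoch (q / x) q n * qpoch_inf (q / x * q ^ n) q) * qpoch_inf q q"
    unfolding theta_j_def qpoch_inf_split[of x "n + 1"] qpoch_inf_split[of "q / x" n] ..
  then show ?thesis
    using assms unfolding lower_term_def lower_reg_def by (auto simp: divide_simps)
qed

section \<open>The q-difference equation of the bilateral series and its solution\<close>

lemma qpoch_nonzero:
  assumes "theta_j x q \<noteq> 0"
  shows "qpoch x q n \<noteq> 0" "qpoch (q / x) q n \<noteq> 0"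
  using assms qpoch_inf_split[of x n] qpoch_inf_split[of "q / x" n] by (auto simp: theta_j_def)

text \<open>Moving a factor from one product to the other, (1/(qx);q)_(n+1) (q^2 x;q)_n = -(1/x;q)_n
  (qx;q)_(n+1)/(qx). Every term is then a multiple of (1/x;q)_n (qx;q)_n, and a polynomial identity
  in q^n remains.\<close>

lemma upper_term_q:
  assumes x: "x \<noteq> 0"
  shows "upper_term q (q * x) n + q * x ^ 3 * upper_term q x n =
    (1 - q * x\<^sup>2) * (qpoch (1 / x) q (Suc n) * qpoch (q * x) q (Suc n) - qpoch (1 / x) q n * qpoch (q * x) q n)"
proof -
  define u P Q where "u = q ^ n" and "P = qpoch (1 / x) q n" and "Q = qpoch (q * x) q n"
  have P: "qpoch (1 / x) q (Suc n) = P * (1 - u / x)" and Q: "qpoch (q * x) q (Suc n) = Q * (1 - q * u * x)"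
    by (simp_all add: qpoch_Suc P_def Q_def u_def mult_ac)
  have "qpoch (1 / (q * x)) q (Suc n) * qpoch (q * (q * x)) q n =
        (1 - 1 / (q * x)) * P * qpoch (q * (q * x)) q n"
    using q0 by (simp add: qpoch_Suc' P_def)
  also have "\<dots> = - 1 / (q * x) * P * ((1 - q * x) * qpoch (q * (q * x)) q n)"
    using q0 x by (simp add: field_simps)
  also have "(1 - q * x) * qpoch (q * (q * x)) q n = Q * (1 - q * u * x)"
    using qpoch_Suc'[of "q * x" n] Q by (simp add: mult.commute)
  finally have up_q: "upper_term q (q * x) n = - u / x * P * Q * (1 - q * u * x)"
    unfolding upper_term_def using q0 x by (simp add: u_def)
  have up: "upper_term q x n = P * (1 - u / x) * Q * (q * u)"
    using P by (simp add: upper_term_def Q_def u_def)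
  show ?thesis
    unfolding up_q up P Q P_def[symmetric] Q_def[symmetric] using x
    by (simp add: field_simps power2_eq_square power3_eq_cube)
qed

text \<open>The continuation of \<open>upper_term_q\<close> to negative indices: \<open>p n\<close>
  is the value of (1/x;q)_m (qx;q)_m at m = -n.\<close>

lemma lower_term_q:
  assumes x: "x \<noteq> 0" and nz: "theta_j x q \<noteq> 0"
  defines "p \<equiv> \<lambda>n. q ^ (n\<^sup>2) / (qpoch (1 / x) q n * qpoch (q * x) q n)"
  shows "lower_term q (q * x) n + q * x ^ 3 * lower_term q x n = (1 - q * x\<^sup>2) * (p n - p (Suc n))"
proof -
  define u P Q where "u = q ^ n" and "P = qpoch (1 / x) q n" and "Q = qpoch (q * x) q n"
  \<comment> \<open>The denominators of \<open>p\<close> are the products (y;q)_m and (q/y;q)_m for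
    y = 1/x.\<close>
  have "theta_j (1 / x) q \<noteq> 0" using nz x by (simp add: theta_j_inverse)
  from qpoch_nonzero[OF this] have n0: "qpoch (1 / x) q m \<noteq> 0" "qpoch (q * x) q m \<noteq> 0" for m
    by (simp_all)
  have P: "qpoch (1 / x) q (Suc n) = P * (1 - u / x)" and Q: "qpoch (q * x) q (Suc n) = Q * (1 - q * u * x)"
    by (simp_all add: qpoch_Suc P_def Q_def u_def mult_ac)
  define s t where "s = 1 - u / x" and "t = 1 - q * u * x"
  have st: "s \<noteq> 0" "t \<noteq> 0" using n0[of "Suc n"] unfolding P Q s_def t_def by auto
  have PQ: "P \<noteq> 0" "Q \<noteq> 0" using n0 by (auto simp: P_def Q_def)
  have x1: "1 - x \<noteq> 0" using nz by auto
  have low_q: "lower_term q (q * x) n = p n / t"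
    using q0 Q unfolding lower_term_def p_def by (simp add: P_def[symmetric] Q_def[symmetric] t_def mult_ac)
  have "(1 - 1 / x) * qpoch (q / x) q n = P * s"
    using qpoch_Suc'[of "1 / x" n] P by (simp add: s_def)
  then have "(1 - x) * qpoch (q / x) q n = - x * (P * s)"
    using x by (simp add: field_simps)
  moreover have "qpoch x q (Suc n) = (1 - x) * Q"
    using qpoch_Suc'[of x n] by (simp add: Q_def mult.commute)
  ultimately have "qpoch x q (n + 1) * qpoch (q / x) q n = - x * s * (P * Q)"
    by (simp add: mult_ac)
  then have low: "lower_term q x n = - p n / (x * s)"
    unfolding lower_term_def p_def P_def[symmetric] Q_def[symmetric] by (simp add: field_simps)
  have "q ^ ((Suc n)\<^sup>2) = q ^ (n\<^sup>2) * (q * u\<^sup>2)"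
    by (simp add: u_def power2_eq_square power_add mult_ac)
  then have pS: "p (Suc n) = p n * (q * u\<^sup>2) / (s * t)"
    unfolding p_def P Q by (simp add: P_def Q_def s_def t_def field_simps)
  have key: "s - q * x\<^sup>2 * t = (1 - q * x\<^sup>2) * (s * t - q * u\<^sup>2)"
    using x by (simp add: s_def t_def field_simps power2_eq_square)
  have "lower_term q (q * x) n + q * x ^ 3 * lower_term q x n = p n / (s * t) * (s - q * x\<^sup>2 * t)"
    unfolding low low_q using st x by (simp add: field_simps power2_eq_square power3_eq_cube)
  also have "\<dots> = (1 - q * x\<^sup>2) * (p n - p (Suc n))"
    unfolding key pS using st by (simp add: field_simps)
  finally show ?thesis .
qed

text \<open>The upper half telescopes to \<theta> - 1 and the lower half to 1 - 0, up to the factor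
  1 - q x^2. The boundary values at n = 0 cancel and only the limit \<theta> at infinity
  remains.\<close>

lemma bilateral_sum_q:
  assumes x: "x \<noteq> 0" and nz: "theta_j x q \<noteq> 0"
  defines "F \<equiv> \<lambda>x. (\<Sum>n. upper_term q x n) + (\<Sum>n. lower_term q x n)"
  shows "F (q * x) = - q * x ^ 3 * F x - (1 - q * x\<^sup>2) * theta_j x q / (x * qpoch_inf q q)"
proof -
  define p where "p = (\<lambda>n. qpoch (1 / x) q n * qpoch (q * x) q n)"
  define \<theta> where "\<theta> = qpoch_inf (1 / x) q * qpoch_inf (q * x) q"
  have p_lim: "p \<longlonglongrightarrow> \<theta>" unfolding p_def \<theta>_def by (intro tendsto_mult qpoch_tendsto)
  have p0: "p 0 = 1" by (simp add: p_def)
  have "\<theta> * qpoch_inf q q = - theta_j x q / x"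
    using theta_j_inverse[OF x] by (simp add: theta_j_def[of "1 / x"] \<theta>_def mult_ac)
  then have \<theta>: "\<theta> = - theta_j x q / (x * qpoch_inf q q)"
    using qpoch_inf_q_nonzero x by (simp add: field_simps)
  have \<theta>0: "\<theta> \<noteq> 0" using nz x qpoch_inf_q_nonzero unfolding \<theta> by simp
  have low_sm: "summable (lower_term q y)" if "theta_j y q \<noteq> 0" for y
    using summable_mult[OF summable_lower_reg, of "qpoch_inf q q / theta_j y q" y]
    unfolding lower_term_eq_reg[OF that, symmetric] .
  have nzq: "theta_j (q * x) q \<noteq> 0" using nz x by (simp add: theta_j_shift)
  have "(\<lambda>n. (1 - q * x\<^sup>2) * (p (Suc n) - p n)) sums ((1 - q * x\<^sup>2) * (\<theta> - p 0))"
    by (intro sums_mult telescope_sums p_lim)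
  then have "(\<lambda>n. upper_term q (q * x) n + q * x ^ 3 * upper_term q x n) sums ((1 - q * x\<^sup>2) * (\<theta> - p 0))"
    unfolding upper_term_q[OF x] p_def .
  moreover have "(\<lambda>n. upper_term q (q * x) n + q * x ^ 3 * upper_term q x n) sums
      ((\<Sum>n. upper_term q (q * x) n) + q * x ^ 3 * (\<Sum>n. upper_term q x n))"
    by (intro sums_add sums_mult summable_sums summable_upper)
  ultimately have up: "(\<Sum>n. upper_term q (q * x) n) + q * x ^ 3 * (\<Sum>n. upper_term q x n) = (1 - q * x\<^sup>2) * (\<theta> - 1)"
    using sums_unique2 p0 by metis
  have "(\<lambda>n. q ^ (n\<^sup>2)) \<longlonglongrightarrow> 0"
  proof (rule Lim_null_comparison)
    show "(\<lambda>n. norm q ^ n) \<longlonglongrightarrow> 0" using q1 by (intro LIMSEQ_realpow_zero) auto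
    have "n \<le> n\<^sup>2" for n :: nat by (cases n) (auto simp: power2_eq_square)
    then show "\<forall>\<^sub>F n in sequentially. norm (q ^ (n\<^sup>2)) \<le> norm q ^ n"
      using q1 by (intro always_eventually allI) (simp add: norm_power power_decreasing)
  qed
  \<comment> \<open>The denominators tend to \<theta>, which is nonzero off the theta zeros.\<close>
  then have lim0: "(\<lambda>n. q ^ (n\<^sup>2) / p n) \<longlonglongrightarrow> 0"
    using tendsto_divide[OF _ p_lim \<theta>0] by fastforce
  have "(\<lambda>n. (1 - q * x\<^sup>2) * (q ^ (n\<^sup>2) / p n - q ^ ((Suc n)\<^sup>2) / p (Suc n))) sums ((1 - q * x\<^sup>2) * (q ^ (0\<^sup>2) / p 0 - 0))"
    by (intro sums_mult telescope_sums'[OF lim0])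
  then have "(\<lambda>n. lower_term q (q * x) n + q * x ^ 3 * lower_term q x n) sums ((1 - q * x\<^sup>2) * (q ^ (0\<^sup>2) / p 0 - 0))"
    unfolding lower_term_q[OF x nz] p_def .
  moreover have "(\<lambda>n. lower_term q (q * x) n + q * x ^ 3 * lower_term q x n) sums
      ((\<Sum>n. lower_term q (q * x) n) + q * x ^ 3 * (\<Sum>n. lower_term q x n))"
    by (intro sums_add sums_mult summable_sums low_sm nz nzq)
  ultimately have low: "(\<Sum>n. lower_term q (q * x) n) + q * x ^ 3 * (\<Sum>n. lower_term q x n) = 1 - q * x\<^sup>2"
    using sums_unique2 p0 by fastforce
  have "F (q * x) + q * x ^ 3 * F x =
      ((\<Sum>n. upper_term q (q * x) n) + q * x ^ 3 * (\<Sum>n. upper_term q x n)) +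
      ((\<Sum>n. lower_term q (q * x) n) + q * x ^ 3 * (\<Sum>n. lower_term q x n))"
    by (simp add: F_def algebra_simps)
  also have "\<dots> = (1 - q * x\<^sup>2) * \<theta>"
    unfolding up low by (simp add: algebra_simps)
  finally have "F (q * x) = - q * x ^ 3 * F x + (1 - q * x\<^sup>2) * \<theta>"
    by (simp add: eq_diff_eq)
  then show ?thesis unfolding \<theta> by simp
qed

lemma bilateral_sum_eq_lerch:
  assumes x: "x \<noteq> 0" and nz: "theta_j x q \<noteq> 0"
  shows "(\<Sum>n. upper_term q x n) + (\<Sum>n. lower_term q x n) = lerch q x (q / x) / qpoch_inf q q"
proof -
  define c where "c = qpoch_inf q q"
  have c0: "c \<noteq> 0" using qpoch_inf_q_nonzero by (simp add: c_def)
  define F where "F = (\<lambda>x. (\<Sum>n. upper_term q x n) + (\<Sum>n. lower_term q x n))"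
  \<comment> \<open>This is j(x;q) times the difference of the two sides, written with the
    regularised series so that it makes sense at the poles too.\<close>
  define d where "d = (\<lambda>x. theta_j x q * (\<Sum>n. upper_term q x n) + c * (\<Sum>n. lower_reg q x n)
                          - lerch_reg q x (q / x) / c)"
  have d_hol: "d holomorphic_on - {0}"
    unfolding d_def using q0 c0
    by (intro holomorphic_intros holomorphic_theta_j holomorphic_upper holomorphic_lower holomorphic_lerch_reg) auto
  have d_eq: "d x = theta_j x q * F x - lerch_reg q x (q / x) / c" if "theta_j x q \<noteq> 0" for x
  proof -
    have "(\<Sum>n. lower_term q x n) = c / theta_j x q * (\<Sum>n. lower_reg q x n)"
      unfolding lower_term_eq_reg[OF that] c_def by (intro suminf_mult summable_lower_reg)
    then show ?thesis using that by (simp add: d_def F_def distrib_left)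
  qed
  have "d (q * x) - q * x\<^sup>2 * d x = 0" if x: "x \<noteq> 0" for x
  proof (rule vanish_off_countable[where f = "\<lambda>x. d (q * x) - q * x\<^sup>2 * d x"])
    show "(\<lambda>x. d (q * x) - q * x\<^sup>2 * d x) holomorphic_on - {0}"
      using d_hol q0
      by (intro holomorphic_intros holomorphic_on_compose_gen[OF _ d_hol, unfolded o_def]) auto
    show "countable {x. x \<noteq> 0 \<and> theta_j (1 * x) q = 0}" by (rule countable_theta_zeros) simp
  next
    fix x :: complex assume x: "x \<noteq> 0" and "x \<notin> {x. x \<noteq> 0 \<and> theta_j (1 * x) q = 0}"
    then have nz: "theta_j x q \<noteq> 0" by simp
    define T where "T = theta_j x q"
    have nzq: "theta_j (q * x) q \<noteq> 0" using nz x by (simp add: theta_j_shift)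
    have inv: "theta_j (1 / x) q = - T / x" using theta_j_inverse[OF x] by (simp add: T_def)
    \<comment> \<open>As x becomes q x, the second argument q/x becomes 1/x. The two shift in
      opposite directions, so both shift formulas are used, meeting at (x, 1/x).\<close>
    have "lerch_reg q (q * x) (1 / x) = - T * (- T / x) / x + q * x * lerch_reg q x (1 / x)"
      using lerch_reg_q_left[of x "1 / x"] x inv by (simp add: T_def)
    moreover have "lerch_reg q x (q / x) = (lerch_reg q x (1 / x) - T * (- T / x)) / x"
      using lerch_reg_q_right[of x "1 / x"] x inv by (simp add: T_def)
    then have "lerch_reg q x (1 / x) = x * lerch_reg q x (q / x) - T\<^sup>2 / x"
      using x by (simp add: field_simps power2_eq_square)
    ultimately have L: "lerch_reg q (q * x) (1 / x) = q * x\<^sup>2 * lerch_reg q x (q / x) + T\<^sup>2 * (1 - q * x\<^sup>2) / x\<^sup>2"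
      using x by (simp add: field_simps power2_eq_square)
    have "F (q * x) = - q * x ^ 3 * F x - (1 - q * x\<^sup>2) * T / (x * c)"
      using bilateral_sum_q[OF x nz] by (simp add: F_def T_def c_def)
    then have "d (q * x) = (- T / x) * (- q * x ^ 3 * F x - (1 - q * x\<^sup>2) * T / (x * c)) - lerch_reg q (q * x) (1 / x) / c"
      using d_eq[OF nzq] q0 x by (simp add: theta_j_shift T_def)
    \<comment> \<open>The terms in T^2 from the bilateral series and from \<open>L\<close> cancel
      here.\<close>
    also have "\<dots> = q * x\<^sup>2 * d x"
      unfolding L d_eq[OF nz] T_def[symmetric] using x c0
      by (simp add: field_simps power2_eq_square power3_eq_cube)
    finally show "d (q * x) - q * x\<^sup>2 * d x = 0" by simp
  qed (fact x)
  then have "d (q * x) = 1 * q * x\<^sup>2 * d x" if "x \<noteq> 0" for x using that by simp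
  from quasi_periodic_imp_zero[OF d_hol _ _ this x] have "d x = 0" by simp
  then have "theta_j x q * F x = theta_j x q * (lerch q x (q / x) / c)"
    using d_eq[OF nz] lerch_reg_eq[OF x nz] by simp
  then have "F x = lerch q x (q / x) / c" using mult_left_cancel[OF nz] by blast
  then show ?thesis by (simp add: F_def c_def)
qed

text \<open>For z = 1/x the pole variable x^2 z is x itself, and the summand 1 in
  \<open>appell_m_eq_lerch\<close> is exactly the theta term produced by shifting z from 1/x to
  q/x.\<close>

lemma appell_m_self_eq_lerch:
  assumes x: "x \<noteq> 0" and nz: "theta_j x q \<noteq> 0"
  shows "appell_m (x\<^sup>2) q (1 / x) = lerch q x (q / x) / theta_j x q"
proof -
  have xx: "x\<^sup>2 * (1 / x) = x" using x by (simp add: power2_eq_square)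
  have inv: "theta_j (1 / x) q = - theta_j x q / x" using theta_j_inverse[OF x] .
  have m_eq: "appell_m (x\<^sup>2) q (1 / x) = (1 - lerch q x (1 / x) / theta_j (1 / x) q) / x\<^sup>2"
    using appell_m_eq_lerch[of "x\<^sup>2" "1 / x"] x nz inv unfolding xx by simp
  have "theta_j x q * lerch q x (q / x) =
      (theta_j x q * lerch q x (1 / x) - theta_j x q * (- theta_j x q / x)) / x"
    using lerch_reg_q_right[of x "1 / x"] x inv nz by (simp add: lerch_reg_eq)
  then have "theta_j x q * lerch q x (q / x) = theta_j x q * ((lerch q x (1 / x) + theta_j x q / x) / x)"
    by (simp add: algebra_simps)
  then have l_eq: "lerch q x (q / x) = (lerch q x (1 / x) + theta_j x q / x) / x"
    using mult_left_cancel[OF nz] by blast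
  show ?thesis
    unfolding m_eq l_eq inv using x nz by (simp add: field_simps power2_eq_square)
qed

subsection \<open>Product identities relating the nomes q and q squared\<close>

lemma q_series_square: "q_series (q\<^sup>2)"
  using q0 q1 by unfold_locales (auto simp: norm_power power_less_one_iff)

lemma qpoch_inf_times_minus: "qpoch_inf x q * qpoch_inf (- x) q = qpoch_inf (x\<^sup>2) (q\<^sup>2)"
proof (rule LIMSEQ_unique)
  interpret sq: q_series "q\<^sup>2" by (rule q_series_square)
  show "(\<lambda>n. qpoch x q n * qpoch (- x) q n) \<longlonglongrightarrow> qpoch_inf x q * qpoch_inf (- x) q"
    by (intro tendsto_mult qpoch_tendsto)
  have "qpoch x q n * qpoch (- x) q n = qpoch (x\<^sup>2) (q\<^sup>2) n" for n
    unfolding qpoch_def prod.distrib[symmetric]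
    by (intro prod.cong) (auto simp: algebra_simps power2_eq_square power_mult_distrib)
  then show "(\<lambda>n. qpoch x q n * qpoch (- x) q n) \<longlonglongrightarrow> qpoch_inf (x\<^sup>2) (q\<^sup>2)"
    using sq.qpoch_tendsto by simp
qed

text \<open>Factors of even and of odd index are collected separately.\<close>

lemma qpoch_inf_dissect: "qpoch_inf x q = qpoch_inf x (q\<^sup>2) * qpoch_inf (q * x) (q\<^sup>2)"
proof (rule LIMSEQ_unique)
  interpret sq: q_series "q\<^sup>2" by (rule q_series_square)
  show "(\<lambda>n. qpoch x q (2 * n)) \<longlonglongrightarrow> qpoch_inf x q"
    by (rule filterlim_compose[OF qpoch_tendsto mult_nat_left_at_top]) simp
  have "qpoch x q (2 * n) = qpoch x (q\<^sup>2) n * qpoch (q * x) (q\<^sup>2) n" for n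
  proof (induction n)
    case (Suc n)
    have "qpoch x q (2 * Suc n) = qpoch x q (Suc (Suc (2 * n)))" by simp
    also have "\<dots> = qpoch x (q\<^sup>2) (Suc n) * qpoch (q * x) (q\<^sup>2) (Suc n)"
      unfolding qpoch_Suc sq.qpoch_Suc Suc.IH power_Suc power_mult by (simp only: mult_ac)
    finally show ?case .
  qed simp
  then show "(\<lambda>n. qpoch x q (2 * n)) \<longlonglongrightarrow> qpoch_inf x (q\<^sup>2) * qpoch_inf (q * x) (q\<^sup>2)"
    by (auto intro!: tendsto_mult sq.qpoch_tendsto)
qed

lemma theta_j_times_minus:
  "theta_j a q * theta_j (- a) q * qpoch_inf (q\<^sup>2) (q\<^sup>2) = theta_j (a\<^sup>2) (q\<^sup>2) * (qpoch_inf q q)\<^sup>2"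
  using qpoch_inf_times_minus[of a] qpoch_inf_times_minus[of "q / a"]
  by (simp add: theta_j_def power_divide power2_eq_square mult_ac)

lemma theta_j_dissect:
  assumes "x \<noteq> 0"
  shows "theta_j x q * (qpoch_inf (q\<^sup>2) (q\<^sup>2))\<^sup>2 =
           theta_j x (q\<^sup>2) * theta_j (q * x) (q\<^sup>2) * qpoch_inf q q"
proof -
  have "q\<^sup>2 / (q * x) = q / x" "q * (q / x) = q\<^sup>2 / x" using q0 by (simp_all add: power2_eq_square)
  then show ?thesis
    using qpoch_inf_dissect[of x] qpoch_inf_dissect[of "q / x"]
    by (simp add: theta_j_def power2_eq_square)
qed

text \<open>The factor 2 is the first factor 1 - (-1) of the product; it is the origin of the 1/2 in
  the theorem.\<close>

lemma theta_j_minus_1: "theta_j (- 1) q * qpoch_inf q q = 2 * (qpoch_inf (q\<^sup>2) (q\<^sup>2))\<^sup>2"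
proof -
  have "theta_j (- 1) q * qpoch_inf q q = 2 * (qpoch_inf q q * qpoch_inf (- q) q)\<^sup>2"
    using qpoch_inf_rec[of "- 1"] by (simp add: theta_j_def power2_eq_square)
  then show ?thesis by (simp only: qpoch_inf_times_minus)
qed

text \<open>The change of parameter with x = a^2, z0 = -1, z1 = -1/a gives J1^2 A^2/(M B D). The
  relations \<open>e1\<close> to \<open>e4\<close> then trade B, M, D for T, V and J2.\<close>

lemma theta_quotient_eq:
  assumes a: "a \<noteq> 0" and nz: "theta_j (a ^ 4) (q\<^sup>2) \<noteq> 0"
  shows "theta_j (- a) q / qpoch_inf q q * (appell_m (a\<^sup>2) q (- 1 / a) - appell_m (a\<^sup>2) q (- 1)) =
    1 / 2 * (theta_j a q ^ 3 * theta_j (q * a\<^sup>2) (q\<^sup>2) /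
      ((qpoch_inf (q\<^sup>2) (q\<^sup>2))\<^sup>2 * theta_j (a ^ 4) (q\<^sup>2)))"
proof -
  interpret sq: q_series "q\<^sup>2" by (rule q_series_square)
  define A B C D M S T V J1 J2 where "A = theta_j a q" and "B = theta_j (- a) q"
    and "C = theta_j (a\<^sup>2) q" and "D = theta_j (- (a\<^sup>2)) q" and "M = theta_j (- 1) q"
    and "S = theta_j (a\<^sup>2) (q\<^sup>2)" and "T = theta_j (q * a\<^sup>2) (q\<^sup>2)" and "V = theta_j (a ^ 4) (q\<^sup>2)"
    and "J1 = qpoch_inf q q" and "J2 = qpoch_inf (q\<^sup>2) (q\<^sup>2)"
  have J0: "J1 \<noteq> 0" "J2 \<noteq> 0"
    using qpoch_inf_q_nonzero sq.qpoch_inf_q_nonzero by (simp_all add: J1_def J2_def)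
  have e1: "A * B * J2 = S * J1\<^sup>2"
    using theta_j_times_minus[of a] by (simp add: A_def B_def J2_def S_def J1_def)
  have e2: "C * D * J2 = V * J1\<^sup>2"
    using theta_j_times_minus[of "a\<^sup>2"] by (simp add: C_def D_def J2_def V_def J1_def power_mult[symmetric])
  have e3: "C * J2\<^sup>2 = S * T * J1"
    using theta_j_dissect[of "a\<^sup>2"] a by (simp add: C_def J2_def S_def T_def J1_def)
  have e4: "M * J1 = 2 * J2\<^sup>2"
    using theta_j_minus_1 by (simp add: M_def J1_def J2_def)
  have "V \<noteq> 0" using nz by (simp add: V_def)
  \<comment> \<open>Nonvanishing propagates from V through the product relations: V gives C and D, C
    gives S, and S gives A and B.\<close>
  then have CD: "C \<noteq> 0" "D \<noteq> 0" using e2 J0 by auto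
  then have ST: "S \<noteq> 0" using e3 J0 by auto
  then have AB: "A \<noteq> 0" "B \<noteq> 0" using e1 J0 by auto
  have M0: "M \<noteq> 0" using e4 J0 by auto
  have i1: "theta_j (1 / a) q = - A / a" using theta_j_inverse[OF a] by (simp add: A_def)
  have i2: "theta_j (- 1 / a) q = B / a" using theta_j_inverse[of "- a"] a by (simp add: B_def)
  have z1: "a\<^sup>2 * (- 1) = - (a\<^sup>2)" "a\<^sup>2 * (- 1 / a) = - a" "a\<^sup>2 * (- 1) * (- 1 / a) = a" "(- 1 / a) / (- 1) = 1 / a"
    using a by (simp_all add: power2_eq_square)
  have "appell_m (a\<^sup>2) q (- 1 / a) - appell_m (a\<^sup>2) q (- 1) =
      - 1 * theta_reg 1 q * (- A / a) * A / (M * (B / a) * D * B)"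
    using appell_m_diff[of "a\<^sup>2" "- 1" "- 1 / a"] a AB CD M0
    unfolding z1 i1 i2 A_def[symmetric] B_def[symmetric] D_def[symmetric] M_def[symmetric]
    by (simp add: power2_eq_square A_def)
  also have "theta_reg 1 q = J1 ^ 3" by (simp add: theta_reg_def J1_def power3_eq_cube)
  finally have "B / J1 * (appell_m (a\<^sup>2) q (- 1 / a) - appell_m (a\<^sup>2) q (- 1)) = J1\<^sup>2 * A\<^sup>2 / (M * B * D)"
    using a J0 AB CD M0 by (simp add: field_simps power2_eq_square power3_eq_cube)
  also have "\<dots> = 1 / 2 * (A ^ 3 * T / (J2\<^sup>2 * V))"
  proof -
    have "J1\<^sup>2 * (A * B * J2 * (M * J1) * T * D) * A\<^sup>2 = J1\<^sup>2 * (S * J1\<^sup>2 * (2 * J2\<^sup>2) * T * D) * A\<^sup>2"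
      by (simp only: e1 e4)
    also have "\<dots> = 2 * J1 ^ 3 * J2\<^sup>2 * (S * T * J1) * D * A\<^sup>2"
      by (simp add: power2_eq_square power3_eq_cube)
    also have "\<dots> = 2 * J1 ^ 3 * J2 ^ 3 * (C * D * J2) * A\<^sup>2"
      unfolding e3[symmetric] by (simp add: power2_eq_square power3_eq_cube)
    also have "\<dots> = J1 ^ 3 * J2 * (2 * J1\<^sup>2 * A\<^sup>2 * J2\<^sup>2 * V)"
      unfolding e2 by (simp add: power2_eq_square power3_eq_cube)
    \<comment> \<open>The auxiliary S and C have been eliminated, at the price of the common factor
      J1^3 J2, which is cancelled next.\<close>
    finally have "(J1 ^ 3 * J2) * (A ^ 3 * T * (M * B * D)) = (J1 ^ 3 * J2) * (2 * J1\<^sup>2 * A\<^sup>2 * J2\<^sup>2 * V)"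
      by (simp add: power2_eq_square power3_eq_cube mult_ac)
    then have "A ^ 3 * T * (M * B * D) = 2 * J1\<^sup>2 * A\<^sup>2 * J2\<^sup>2 * V"
      using J0 by (subst (asm) mult_left_cancel) auto
    then show ?thesis
      using M0 AB CD J0 \<open>V \<noteq> 0\<close> by (simp add: divide_simps mult_ac)
  qed
  finally show ?thesis unfolding A_def B_def J1_def J2_def T_def V_def .
qed

end

section \<open>Assembly of the two equalities\<close>

theorem theorem4p1:
  fixes q a :: complex
  assumes "0 < norm q" and "norm q < 1"
    and "a \<noteq> 0"
    and "mock_g_defined (- a) q"
    and "appell_m_defined (a\<^sup>2) q (- inverse a)"
    and "appell_m_defined (a\<^sup>2) q (- 1)"
    and "theta_j (a ^ 4) (q\<^sup>2) \<noteq> 0"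
  shows "(1 + 1 / a) * (\<Sum>n. q ^ (n + 1) * qpoch (- q / a) q n * qpoch (- a * q) q n)
           = - 1 + a * mock_g (- a) q
             + theta_j (- a) q / J q 1 * appell_m (a\<^sup>2) q (- inverse a)
       \<and> - 1 + a * mock_g (- a) q
             + theta_j (- a) q / J q 1 * appell_m (a\<^sup>2) q (- inverse a)
           = - 1 + a * mock_g (- a) q
             + theta_j (- a) q / J q 1 * appell_m (a\<^sup>2) q (- 1)
             + 1 / 2 * (theta_j a q ^ 3 * theta_j (q * a\<^sup>2) (q\<^sup>2)
                        / ((J q 2)\<^sup>2 * theta_j (a ^ 4) (q\<^sup>2)))"
proof -
  interpret q_series q using assms(1,2) by unfold_locales auto
  define x where "x = - a"
  have x: "x \<noteq> 0" "1 / x = - inverse a" "x\<^sup>2 = a\<^sup>2"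
    using \<open>a \<noteq> 0\<close> by (simp_all add: x_def divide_inverse)
  have "theta_j (1 / x) q \<noteq> 0"
    using assms(5) by (simp add: appell_m_defined_def x)
  then have nz: "theta_j x q \<noteq> 0" using theta_j_inverse[OF x(1)] by auto
  have J1: "J q 1 = qpoch_inf q q" and J2: "J q 2 = qpoch_inf (q\<^sup>2) (q\<^sup>2)"
    by (simp_all add: J_def)
  \<comment> \<open>It equals 1 - 1/x, and x = 1 is a zero of the theta function. Nonvanishing
    allows this factor to be moved into the series.\<close>
  have "1 + 1 / a \<noteq> 0"
  proof
    assume "1 + 1 / a = 0"
    then have "x = 1" using \<open>a \<noteq> 0\<close> by (simp add: x_def field_simps add_eq_0_iff)
    then show False using nz by simp
  qed
  then have "q ^ (n + 1) * qpoch (- q / a) q n * qpoch (- a * q) q n = upper_term q x n / (1 + 1 / a)" for n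
    using qpoch_Suc'[of "1 / x" n] by (simp add: upper_term_def x_def mult_ac)
  then have upper: "(1 + 1 / a) * (\<Sum>n. q ^ (n + 1) * qpoch (- q / a) q n * qpoch (- a * q) q n)
        = (\<Sum>n. upper_term q x n)"
    using \<open>1 + 1 / a \<noteq> 0\<close> suminf_divide[OF summable_upper, of x "1 + 1 / a"] by simp
  \<comment> \<open>The factor a = -x cancels the x^(-1) of g up to sign, and the two constants
    cancel; the minus sign makes this the lower half brought to the other side.\<close>
  have lower: "- 1 + a * mock_g (- a) q = - (\<Sum>n. lower_term q x n)"
  proof -
    have "mock_g (- a) q = inverse (- a) * (- 1 + (\<Sum>n. lower_term q x n))"
      by (simp add: mock_g_def lower_term_def[abs_def] x_def)
    then show ?thesis using \<open>a \<noteq> 0\<close> by (simp add: field_simps)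
  qed
  have appell: "theta_j (- a) q / J q 1 * appell_m (a\<^sup>2) q (- inverse a) = lerch q x (q / x) / qpoch_inf q q"
    using appell_m_self_eq_lerch[OF x(1) nz] nz unfolding x(2,3) J1 x_def[symmetric] by simp
  have first: "(1 + 1 / a) * (\<Sum>n. q ^ (n + 1) * qpoch (- q / a) q n * qpoch (- a * q) q n)
      = - 1 + a * mock_g (- a) q + theta_j (- a) q / J q 1 * appell_m (a\<^sup>2) q (- inverse a)"
    unfolding upper lower appell bilateral_sum_eq_lerch[OF x(1) nz, symmetric] by simp
  have "- 1 / a = - inverse a" by (simp add: divide_inverse)
  note theta_quotient_eq[OF \<open>a \<noteq> 0\<close> assms(7), folded J1 J2, unfolded this]
  then have second: "theta_j (- a) q / J q 1 * appell_m (a\<^sup>2) q (- inverse a) =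
      theta_j (- a) q / J q 1 * appell_m (a\<^sup>2) q (- 1)
             + 1 / 2 * (theta_j a q ^ 3 * theta_j (q * a\<^sup>2) (q\<^sup>2)
                        / ((J q 2)\<^sup>2 * theta_j (a ^ 4) (q\<^sup>2)))"
    by (simp only: right_diff_distrib diff_eq_eq add.commute)
  show ?thesis
    by (intro conjI first) (simp only: second add.assoc)
qed

end
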